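(* Let $\alpha\in\mathbb{R}$ and $f,g\in L_1(\mathbb{R}_+;2x^{\alpha/2}K_\alpha(2\sqrt{x})\,dx)$. Then the convolution $$(f*g)(x)=2\int_{\mathbb{R}_+^2}K_0\left(2\sqrt{\frac{(x+u)(x+v)}{x}}\right)f(u)g(v)\,du\,dv$$ exists (for almost all $x>0$) and belongs to the space $L_1(\mathbb{R}_+;x^{\alpha-1}dx)$, satisfying the Young type inequality $$\|f*g\|_{L_1(\mathbb{R}_+;x^{\alpha-1}dx)}\le\|f\|_{L_1(\mathbb{R}_+;2x^{\alpha/2}K_\alpha(2\sqrt{x})dx)}\,\|g\|_{L_1(\mathbb{R}_+;2x^{\alpha/2}K_\alpha(2\sqrt{x})dx)}.$$ Moreover, the form $(f,g)\mapsto f*g$ is commutative and the factorization equality $$\left(\mathcal{M}(f*g)\right)(z)=(Ff)(z)(Fg)(z)$$ holds, where $z$ belongs to the half-plane $\operatorname{Re} z\ge0$ if $\alpha\ge0$, and $\operatorname{Re} z\ge\alpha$ if $\alpha<0$.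
   Context: $\mathbb{R}_+=(0,\infty)$. $K_z$ is the modified Bessel function of the second kind of complex order $z$. The transformation $F$ is $(Ff)(z)=2\int_0^\infty x^{z/2}K_z(2\sqrt{x})f(x)\,dx$ and the Mellin transform is $(\mathcal{M}f)(z)=\int_0^\infty f(x)x^{z-1}\,dx$. The weighted space $L_1(\mathbb{R}_+;w(x)dx)$ has norm $\int_0^\infty|f(x)|w(x)\,dx$; in particular $\|f\|_{L_1(\mathbb{R}_+;2x^{\alpha/2}K_\alpha(2\sqrt{x})dx)}=2\int_0^\infty|f(x)|x^{\alpha/2}K_\alpha(2\sqrt{x})\,dx$.
   Formalization: The factorization equality is stated for z in the half-plane where (Ff)(z), (Fg)(z) and M(f*g)(z) converge absolutely; this can fail for Re z > α, or Re z = 0 < α. Convergence is proved for 0 < Re z ≤ α, or Re z = α ≤ 0; for Re z > 0 or α ≤ 0, M(f*g)(z) converges when Ff(z), Fg(z) do. *)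

theory Defs
  imports "HOL-Analysis.Analysis"
begin

text \<open>
  Modified Bessel function of the second kind of order \<open>z\<close>, given for arguments \<open>x > 0\<close> by
  the classical integral \<open>K\<^sub>z(x) = \<integral>\<^sub>0\<^sup>\<infinity> exp (- x cosh t) cosh (z t) dt\<close>, which converges
  absolutely for every complex \<open>z\<close>.  It is polymorphic in the order so that real orders give
  real values (see \<open>bessel_K_of_real\<close>).
\<close>
definition bessel_K ::
    "'a :: {banach, real_normed_field, second_countable_topology} \<Rightarrow> real \<Rightarrow> 'a" where
  "bessel_K z x = (LBINT t:{0<..}. exp (- x * cosh t) *\<^sub>R cosh (t *\<^sub>R z))"

lemma bessel_K_of_real: "bessel_K (of_real a :: complex) x = of_real (bessel_K a x)"
proof -
  have "cosh (t *\<^sub>R (of_real a :: complex)) = of_real (cosh (t * a))" for t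
    by (simp add: cosh_def scaleR_conv_of_real exp_of_real flip: of_real_mult of_real_minus)
  then show ?thesis
    unfolding bessel_K_def set_lebesgue_integral_def
    by (simp add: scaleR_conv_of_real flip: of_real_mult integral_complex_of_real)
qed

text \<open>
  Functions on the half-line are represented by \<open>real \<Rightarrow> complex\<close>; only values on \<open>{0<..}\<close> matter.
  Existence of an integral always means Lebesgue (absolute) integrability and is stated
  explicitly, because the integral of a non-integrable function is \<open>0\<close> by convention.
\<close>
definition weighted_L1 :: "(real \<Rightarrow> real) \<Rightarrow> (real \<Rightarrow> complex) set" where
  "weighted_L1 w = {f. set_integrable lborel {0<..} (\<lambda>x. w x *\<^sub>R f x)}"

definition weighted_L1_norm :: "(real \<Rightarrow> real) \<Rightarrow> (real \<Rightarrow> complex) \<Rightarrow> real" where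
  "weighted_L1_norm w f = (LBINT x:{0<..}. norm (f x) * w x)"

definition K_weight :: "real \<Rightarrow> real \<Rightarrow> real" where
  "K_weight \<alpha> x = 2 * x powr (\<alpha> / 2) * bessel_K \<alpha> (2 * sqrt x)"

definition F_integrand :: "(real \<Rightarrow> complex) \<Rightarrow> complex \<Rightarrow> real \<Rightarrow> complex" where
  "F_integrand f z x = of_real x powr (z / 2) * bessel_K z (2 * sqrt x) * f x"

definition F_exists :: "(real \<Rightarrow> complex) \<Rightarrow> complex \<Rightarrow> bool" where
  "F_exists f z \<longleftrightarrow> set_integrable lborel {0<..} (F_integrand f z)"

definition F_transform :: "(real \<Rightarrow> complex) \<Rightarrow> complex \<Rightarrow> complex" where
  "F_transform f z = 2 * (LBINT x:{0<..}. F_integrand f z x)"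

definition mellin_integrand :: "(real \<Rightarrow> complex) \<Rightarrow> complex \<Rightarrow> real \<Rightarrow> complex" where
  "mellin_integrand f z x = f x * of_real x powr (z - 1)"

definition mellin_exists :: "(real \<Rightarrow> complex) \<Rightarrow> complex \<Rightarrow> bool" where
  "mellin_exists f z \<longleftrightarrow> set_integrable lborel {0<..} (mellin_integrand f z)"

definition mellin :: "(real \<Rightarrow> complex) \<Rightarrow> complex \<Rightarrow> complex" where
  "mellin f z = (LBINT x:{0<..}. mellin_integrand f z x)"

definition conv_integrand ::
    "(real \<Rightarrow> complex) \<Rightarrow> (real \<Rightarrow> complex) \<Rightarrow> real \<Rightarrow> real \<times> real \<Rightarrow> complex" where
  "conv_integrand f g x = (\<lambda>(u, v).
     bessel_K (0::real) (2 * sqrt ((x + u) * (x + v) / x)) *\<^sub>R (f u * g v))"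

definition conv_exists :: "(real \<Rightarrow> complex) \<Rightarrow> (real \<Rightarrow> complex) \<Rightarrow> real \<Rightarrow> bool" where
  "conv_exists f g x \<longleftrightarrow> set_integrable lborel ({0<..} \<times> {0<..}) (conv_integrand f g x)"

definition conv :: "(real \<Rightarrow> complex) \<Rightarrow> (real \<Rightarrow> complex) \<Rightarrow> real \<Rightarrow> complex" where
  "conv f g x = 2 * (LBINT p:{0<..} \<times> {0<..}. conv_integrand f g x p)"

end

theory Submission
  imports Defs "HOL-Real_Asymp.Real_Asymp"
begin

text \<open>
  Put \<open>k\<^sub>z(x) = 2 x\<^bsup>z/2\<^esup> K\<^sub>z(2 \<surd>x)\<close>, so that \<open>F f (z) = \<integral> k\<^sub>z f\<close> and the weight of the space is \<open>k\<^sub>\<alpha>\<close>.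
  On the whole line, \<open>k\<^sub>z(x) = \<integral> exp (- e\<^sup>s - x e\<^sup>-\<^sup>s) e\<^sup>z\<^sup>s ds\<close>.  Multiplying two such integrals and
  replacing the second variable by the sum \<open>y\<close> of both turns the product \<open>k\<^sub>z(u) k\<^sub>z(v)\<close> into an
  outer integral of \<open>e\<^sup>z\<^sup>y\<close> against an inner integral which has again the double exponential shape,
  of order \<open>0\<close>; with \<open>x = e\<^sup>y\<close> this is the product formula \<open>mellin_conv_kernel\<close>
    \<open>\<integral> x\<^bsup>z-1\<^esup> 2 K\<^sub>0(2 \<surd>((x+u)(x+v)/x)) dx = k\<^sub>z(u) k\<^sub>z(v)\<close>.
  The kernel is positive, so for \<open>f\<close>, \<open>g\<close> integrable against \<open>k\<^bsub>Re z\<^esub>\<close> Fubini's theorem gives at once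
  the existence of \<open>f * g\<close> almost everywhere, its integrability, and the factorization
  (\<open>conv_absolutely_convergent\<close>).  Young's inequality is the factorization at the point \<open>\<alpha>\<close> for
  the functions \<open>\<bar>f\<bar>\<close> and \<open>\<bar>g\<bar>\<close>.

  The half-plane is reached by deciding when integrability against \<open>k\<^sub>\<alpha>\<close> can be traded for
  integrability against \<open>k\<^sub>c\<close>, \<open>c = Re z\<close>.  For \<open>0 < c \<le> \<alpha>\<close> the weight \<open>k\<^sub>\<alpha>\<close> dominates \<open>k\<^sub>c\<close>
  everywhere.  For \<open>c \<ge> \<alpha>\<close> it does so only on bounded intervals \<open>(0, X]\<close>; near infinity the
  existence of \<open>F f (z)\<close> supplies the rest, because \<open>\<bar>K\<^sub>z(y)\<bar>\<close> is comparable to \<open>K\<^sub>c(y)\<close> for large \<open>y\<close>,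
  even though \<open>K\<^sub>z\<close> may vanish elsewhere.

  The remaining points are those of the boundary line \<open>Re z = 0\<close> when \<open>\<alpha> > 0\<close>.  At \<open>z = 0\<close> the
  kernel is positive, so existence of \<open>F f (0)\<close> is already absolute integrability against \<open>k\<^sub>0\<close>.  At
  \<open>z \<noteq> 0\<close> the triple integral need not converge absolutely, since \<open>k\<^sub>0\<close> has a logarithmic
  singularity; but \<open>k\<^sub>z\<close> itself stays bounded near \<open>0\<close>, uniformly for arguments slightly to the right
  of \<open>z\<close>, as the recurrence relation of \<open>K\<close> shows.  So the factorization at \<open>z + \<epsilon>\<close> passes to
  the limit \<open>\<epsilon> \<rightarrow> 0\<close> by dominated convergence (\<open>mellin_conv_boundary\<close>).
\<close>

section \<open>Auxiliary facts on integrals\<close>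
lemma has_bochner_integral_mono_real:
  fixes f g :: "'a \<Rightarrow> real"
  assumes "has_bochner_integral M f a" "has_bochner_integral M g b" "\<And>x. f x \<le> g x"
  shows "a \<le> b"
  using assms integral_mono[of M f g] by (simp add: has_bochner_integral_iff)

lemma integrable_cmult_iff:
  fixes f :: "'a \<Rightarrow> complex"
  assumes "c \<noteq> 0"
  shows "integrable M (\<lambda>x. c * f x) \<longleftrightarrow> integrable M f"
  using integrable_mult_right[of c M f] integrable_mult_right[of "1 / c" M "\<lambda>x. c * f x"] assms
  by auto

lemma
  fixes f g :: "real \<Rightarrow> 'a :: {real_normed_field, banach, second_countable_topology}"
  assumes f: "integrable lborel f" and g: "integrable lborel g"
  shows integrable_tensor: "integrable (lborel \<Otimes>\<^sub>M lborel) (\<lambda>(u, v). f u * g v)"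
    and integral_tensor: "(\<integral>(u, v). f u * g v \<partial>(lborel \<Otimes>\<^sub>M lborel)) = integral\<^sup>L lborel f * integral\<^sup>L lborel g"
proof -
  have [measurable]: "f \<in> borel_measurable borel" "g \<in> borel_measurable borel"
    using f g by (auto dest: borel_measurable_integrable)
  show int: "integrable (lborel \<Otimes>\<^sub>M lborel) (\<lambda>(u, v). f u * g v)"
    by (rule lborel_pair.Fubini_integrable)
       (auto simp: norm_mult intro!: integrable_mult_left integrable_mult_right integrable_norm f g)
  show "(\<integral>(u, v). f u * g v \<partial>(lborel \<Otimes>\<^sub>M lborel)) = integral\<^sup>L lborel f * integral\<^sup>L lborel g"
    using lborel_pair.integral_fst[OF int] f g by simp
qed

lemma borel_measurable_cosh [measurable (raw)]:
  fixes f :: "'a \<Rightarrow> 'b :: {banach, real_normed_field, second_countable_topology}"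
  assumes "f \<in> borel_measurable M"
  shows "(\<lambda>x. cosh (f x)) \<in> borel_measurable M"
  by (rule measurable_compose[OF assms borel_measurable_continuous_onI]) (intro continuous_intros)

lemma exp_substitution:
  fixes h :: "real \<Rightarrow> complex"
  assumes [measurable]: "h \<in> borel_measurable borel"
  shows "integrable lborel (\<lambda>y. h (exp y)) \<longleftrightarrow> set_integrable lborel {0<..} (\<lambda>x. h x /\<^sub>R x)"
    and "integrable lborel (\<lambda>y. h (exp y)) \<Longrightarrow>
           (LBINT x:{0<..}. h x /\<^sub>R x) = (LBINT y. h (exp y))"
proof -
  let ?f = "\<lambda>x. h x /\<^sub>R x"
  have img: "range exp = {0::real<..}"
    by (auto simp: image_iff) (metis exp_ln)
  have pull: "\<bar>exp y\<bar> *\<^sub>R ?f (exp y) = h (exp y)" for y :: real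
    by simp
  have L: "set_integrable lborel UNIV (\<lambda>y. h (exp y)) \<longleftrightarrow> set_integrable lebesgue UNIV (\<lambda>y. h (exp y))"
    unfolding set_integrable_def by (rule integrable_completion[symmetric]) simp
  have R: "set_integrable lborel {0<..} ?f \<longleftrightarrow> set_integrable lebesgue {0<..} ?f"
    unfolding set_integrable_def by (rule integrable_completion[symmetric]) simp
  have "set_integrable lebesgue {0<..} ?f \<longleftrightarrow>
        set_integrable lebesgue UNIV (\<lambda>y. h (exp y))"
    using absolutely_integrable_change_of_variables_real[of UNIV "exp :: real \<Rightarrow> real" exp ?f]
    unfolding img pull by (auto intro!: derivative_eq_intros inj_onI)
  with L R show iff: "integrable lborel (\<lambda>y. h (exp y)) \<longleftrightarrow> set_integrable lborel {0<..} ?f"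
    by (simp add: set_integrable_def)
  assume int: "integrable lborel (\<lambda>y. h (exp y))"
  then have intU: "set_integrable lborel UNIV (\<lambda>y. h (exp y))"
    by (simp add: set_integrable_def)
  have int0: "set_integrable lborel {0<..} ?f"
    using int iff by simp
  have "integral {0<..} ?f = integral UNIV (\<lambda>y. h (exp y))"
    using has_absolute_integral_change_of_variables_real[of UNIV "exp :: real \<Rightarrow> real" exp ?f
        "integral UNIV (\<lambda>y. h (exp y))"] intU L
    unfolding img pull by (auto intro!: derivative_eq_intros inj_onI)
  then show "(LBINT x:{0<..}. ?f x) = (LBINT y. h (exp y))"
    using set_borel_integral_eq_integral(2)[OF int0] set_borel_integral_eq_integral(2)[OF intU]
    by (simp add: set_lebesgue_integral_def)
qed

section \<open>Double exponential integrals\<close>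

text \<open>
  Modified Bessel functions are integrals of this weight against \<open>e\<^sup>s\<^sup>z\<close>.  Two separate
  coefficients are kept because the product formula produces weights with both different from \<open>1\<close>.
\<close>
definition double_exp :: "real \<Rightarrow> real \<Rightarrow> real \<Rightarrow> real" where
  "double_exp a b s = exp (- (a * exp s + b * exp (- s)))"

lemma double_exp_pos: "0 < double_exp a b s"
  by (simp add: double_exp_def)

lemma double_exp_reflect: "double_exp a b (- s) = double_exp b a s"
  by (simp add: double_exp_def add.commute)

lemma double_exp_antimono: "a \<le> a' \<Longrightarrow> b \<le> b' \<Longrightarrow> double_exp a' b' s \<le> double_exp a b s"
  unfolding double_exp_def exp_le_cancel_iff neg_le_iff_le
  by (intro add_mono mult_right_mono) auto

lemma borel_measurable_double_exp [measurable (raw)]: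
  assumes [measurable]: "f \<in> borel_measurable M" "g \<in> borel_measurable M" "h \<in> borel_measurable M"
  shows "(\<lambda>x. double_exp (f x) (g x) (h x)) \<in> borel_measurable M"
  unfolding double_exp_def by measurable

text \<open>
  With \<open>x = e\<^sup>s\<close> this is the convergence of the Gamma integral at \<open>c > 0\<close>.
\<close>
lemma integrable_double_exp_one_sided:
  assumes "0 < a" "0 < c"
  shows "integrable lborel (\<lambda>s. double_exp a 0 s * exp (s * c))"
proof -
  let ?h = "\<lambda>x::real. complex_of_real (x powr c * exp (- a * x))"
  have "set_integrable lebesgue {0<..} (\<lambda>t. of_real t powr (of_real c - 1) / complex_of_real (exp (a * t)))"
    using absolutely_integrable_Gamma_integral[of "of_real c" a] assms by simp
  also have "?this \<longleftrightarrow> set_integrable lebesgue {0<..} (\<lambda>x. ?h x /\<^sub>R x)"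
  proof (intro set_integrable_cong refl)
    fix t :: real assume "t \<in> {0<..}"
    then have "complex_of_real t powr (of_real c - 1) = of_real (t powr c / t)"
      using powr_of_real[of t "c - 1"] by (simp add: powr_diff)
    then show "complex_of_real t powr (of_real c - 1) / of_real (exp (a * t)) = ?h t /\<^sub>R t"
      by (simp only:) (simp add: scaleR_conv_of_real divide_inverse exp_minus mult_ac)
  qed
  also have "\<dots> \<longleftrightarrow> set_integrable lborel {0<..} (\<lambda>x. ?h x /\<^sub>R x)"
    unfolding set_integrable_def by (rule integrable_completion) simp
  also have "\<dots> \<longleftrightarrow> integrable lborel (\<lambda>y. ?h (exp y))"
    by (rule exp_substitution(1)[symmetric]) simp
  also have "(\<lambda>y. ?h (exp y)) = (\<lambda>s. complex_of_real (double_exp a 0 s * exp (s * c)))"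
    by (auto simp: double_exp_def powr_def mult_ac)
  finally have "integrable lborel (\<lambda>s. complex_of_real (double_exp a 0 s * exp (s * c)))" .
  from integrable_Re[OF this] show ?thesis by simp
qed

text \<open>
  Each half-line is reduced to the one-sided case: on \<open>s \<ge> 0\<close> only the decay of \<open>exp (- a e\<^sup>s)\<close> is
  used, on \<open>s \<le> 0\<close> only that of \<open>exp (- b e\<^sup>-\<^sup>s)\<close>, and there \<open>e\<^sup>s\<^sup>c\<close> may be enlarged to an exponential
  of the sign that the Gamma integral requires.
\<close>
lemma integrable_double_exp_real:
  assumes "0 < a" "0 < b"
  shows "integrable lborel (\<lambda>s. double_exp a b s * exp (s * c))"
proof (rule Bochner_Integration.integrable_bound)
  let ?d = "\<bar>c\<bar> + 1"
  have "integrable lborel (\<lambda>s. double_exp b 0 (0 + (-1) * s) * exp ((0 + (-1) * s) * ?d))"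
    by (rule lborel_integrable_real_affine[OF integrable_double_exp_one_sided]) (use assms in auto)
  then show "integrable lborel (\<lambda>s. double_exp a 0 s * exp (s * ?d) + double_exp b 0 (- s) * exp (- s * ?d))"
    by (intro Bochner_Integration.integrable_add integrable_double_exp_one_sided) (use assms in auto)
  have "double_exp a b s * exp (s * c)
      \<le> double_exp a 0 s * exp (s * ?d) + double_exp b 0 (- s) * exp (- s * ?d)" for s
  proof (cases "0 \<le> s")
    case True
    then have "double_exp a b s * exp (s * c) \<le> double_exp a 0 s * exp (s * ?d)"
      using assms by (intro mult_mono double_exp_antimono)
        (auto simp: double_exp_pos less_imp_le intro!: mult_left_mono)
    then show ?thesis by (simp add: double_exp_pos add_increasing2 less_imp_le)
  next
    case False
    have "s * c \<le> - s * ?d"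
      using False mult_left_mono[of "-c" ?d "-s"] by simp
    then have "double_exp a b s * exp (s * c) \<le> double_exp b 0 (- s) * exp (- s * ?d)"
      unfolding double_exp_reflect
      using assms by (intro mult_mono double_exp_antimono) (auto simp: double_exp_pos less_imp_le)
    then show ?thesis by (simp add: double_exp_pos add_increasing less_imp_le)
  qed
  then show "AE s in lborel. norm (double_exp a b s * exp (s * c))
      \<le> norm (double_exp a 0 s * exp (s * ?d) + double_exp b 0 (- s) * exp (- s * ?d))"
    by (auto simp: double_exp_pos abs_of_pos less_imp_le intro!: AE_I2 order_trans[OF _ abs_ge_self])
qed simp

lemma norm_double_exp_integrand:
  "norm (double_exp a b s *\<^sub>R exp (s *\<^sub>R z)) = double_exp a b s * exp (s * Re z)" for z :: complex
  by (simp add: double_exp_pos abs_of_pos)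

lemma integrable_double_exp:
  fixes z :: complex
  assumes "0 < a" "0 < b"
  shows "integrable lborel (\<lambda>s. double_exp a b s *\<^sub>R exp (s *\<^sub>R z))"
  by (rule Bochner_Integration.integrable_bound[OF integrable_double_exp_real[OF assms, of "Re z"]])
     (auto simp: norm_double_exp_integrand double_exp_pos abs_of_pos simp del: norm_scaleR)

lemma exp_scaleR_add: "exp ((r + t) *\<^sub>R z) = exp (r *\<^sub>R z) * exp (t *\<^sub>R z)" for z :: complex
  by (simp add: scaleR_add_left exp_add)

text \<open>
  Folding the line at the origin replaces \<open>e\<^sup>t\<^sup>z\<close> by \<open>2 cosh (t z)\<close> on the half-line.
\<close>
lemma has_bochner_integral_double_exp_symmetric:
  fixes z :: complex
  assumes "0 < y"
  shows "has_bochner_integral lborel (\<lambda>t. exp (- y * cosh t) *\<^sub>R exp (t *\<^sub>R z)) (2 * bessel_K z y)"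
proof -
  let ?g = "\<lambda>t. exp (- y * cosh t) *\<^sub>R exp (t *\<^sub>R z)"
  have "(\<lambda>t. double_exp (y / 2) (y / 2) t *\<^sub>R exp (t *\<^sub>R z)) = ?g"
    by (intro ext arg_cong2[where f = scaleR]) (simp_all add: double_exp_def cosh_def field_simps)
  with integrable_double_exp[of "y / 2" "y / 2" z] assms have int: "integrable lborel ?g"
    by simp
  have int_refl: "integrable lborel (\<lambda>t. ?g (- t))"
    using lborel_integrable_real_affine[OF int, of "-1" 0] by simp
  have on: "set_integrable lborel A ?g" "set_integrable lborel A (\<lambda>t. ?g (- t))" if "A \<in> sets borel" for A
    unfolding set_integrable_def
    by (intro integrable_mult_indicator int int_refl; use that in simp)+
  have "2 * bessel_K z y = (LBINT t:{0<..}. ?g t + ?g (- t))"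
    unfolding bessel_K_def set_lebesgue_integral_def integral_mult_right_zero[symmetric]
    by (intro Bochner_Integration.integral_cong)
       (auto simp: cosh_def scaleR_conv_of_real field_simps)
  also have "\<dots> = (LBINT t:{0<..}. ?g t) + (LBINT t:{0<..}. ?g (- t))"
    by (intro set_integral_add on) auto
  also have "(LBINT t:{0<..}. ?g (- t)) = (LBINT t:{..<0}. ?g t)"
    using set_integral_reflect[of "{..<0}" ?g] by (simp add: lessThan_def greaterThan_def)
  also have "(LBINT t:{0<..}. ?g t) + (LBINT t:{..<0}. ?g t) = (LBINT t:{0<..} \<union> {..<0}. ?g t)"
    by (rule set_integral_Un[OF _ on(1) on(1), symmetric]) auto
  also have "\<dots> = (LBINT t. ?g t)"
    unfolding set_lebesgue_integral_def
  proof (rule integral_cong_AE)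
    have "AE t in lborel. t \<noteq> (0::real)"
      by (rule AE_lborel_singleton)
    then show "AE t in lborel. indicator ({0<..} \<union> {..<0}) t *\<^sub>R ?g t = ?g t"
      by eventually_elim (auto simp: indicator_def)
  qed measurable
  finally show ?thesis
    using int by (simp add: has_bochner_integral_iff)
qed

text \<open>
  Translating by \<open>r = ln (b/a) / 2\<close> balances the two exponentials: both coefficients become
  \<open>\<surd>(a b)\<close>, at the cost of the factor \<open>e\<^sup>r\<^sup>z\<close>.
\<close>
lemma has_bochner_integral_double_exp:
  fixes z :: complex
  assumes "0 < a" "0 < b"
  shows "has_bochner_integral lborel (\<lambda>s. double_exp a b s *\<^sub>R exp (s *\<^sub>R z))
           (2 * of_real (b / a) powr (z / 2) * bessel_K z (2 * sqrt (a * b)))"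
proof -
  define r where "r = ln (b / a) / 2"
  have er: "exp r = sqrt (b / a)" "exp (- r) = sqrt (a / b)"
    using assms by (simp_all add: r_def exp_minus real_sqrt_divide flip: ln_sqrt)
  have balanced: "a * exp r = sqrt (a * b)" "b * exp (- r) = sqrt (a * b)"
    using assms by (simp_all add: er real_sqrt_divide real_sqrt_mult field_simps flip: power2_eq_square)
  have dbl: "double_exp a b (r + t) = exp (- (2 * sqrt (a * b)) * cosh t)" for t
  proof -
    have "a * exp (r + t) = sqrt (a * b) * exp t"
      by (simp only: exp_add balanced mult.assoc[symmetric])
    moreover have "b * exp (- (r + t)) = sqrt (a * b) * exp (- t)"
      by (simp only: minus_add_distrib exp_add balanced mult.assoc[symmetric])
    ultimately show ?thesis
      by (simp add: double_exp_def cosh_def distrib_left)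
  qed
  have pw: "of_real (b / a) powr (z / 2) = exp (r *\<^sub>R z)"
  proof -
    have "Ln (of_real (b / a)) = of_real (ln (b / a))"
      using assms by (intro Ln_of_real) simp
    moreover have "r *\<^sub>R z = z / 2 * of_real (ln (b / a))"
      by (simp add: r_def scaleR_conv_of_real)
    moreover have "complex_of_real (b / a) \<noteq> 0"
      using assms by simp
    ultimately show ?thesis
      by (simp only: powr_def if_False)
  qed
  have "has_bochner_integral lborel
          (\<lambda>t. exp (r *\<^sub>R z) * (exp (- (2 * sqrt (a * b)) * cosh t) *\<^sub>R exp (t *\<^sub>R z)))
          (exp (r *\<^sub>R z) * (2 * bessel_K z (2 * sqrt (a * b))))"
    by (intro has_bochner_integral_mult_right has_bochner_integral_double_exp_symmetric)
       (use assms in auto)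
  then show ?thesis
    unfolding pw
    by (subst lborel_has_bochner_integral_real_affine_iff[where c = 1 and t = r])
       (simp_all add: dbl exp_scaleR_add mult_ac)
qed

section \<open>The kernel of the transformation and the product formula\<close>

text \<open>
  Twice the kernel that appears in the transformation, so that the weight is its restriction to
  real orders.
\<close>
definition K_kernel :: "complex \<Rightarrow> real \<Rightarrow> complex" where
  "K_kernel z x = 2 * of_real x powr (z / 2) * bessel_K z (2 * sqrt x)"

lemma has_bochner_integral_K_kernel:
  "0 < x \<Longrightarrow> has_bochner_integral lborel (\<lambda>s. double_exp 1 x s *\<^sub>R exp (s *\<^sub>R z)) (K_kernel z x)"
  using has_bochner_integral_double_exp[of 1 x z] by (simp add: K_kernel_def)

lemma K_kernel_of_real: "0 < x \<Longrightarrow> K_kernel (of_real c) x = of_real (K_weight c x)"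
  using powr_of_real[of x "c / 2"] by (simp add: K_kernel_def K_weight_def bessel_K_of_real)

lemma has_bochner_integral_K_weight:
  assumes "0 < x"
  shows "has_bochner_integral lborel (\<lambda>s. double_exp 1 x s * exp (s * c)) (K_weight c x)"
proof -
  have "(\<lambda>s. double_exp 1 x s *\<^sub>R exp (s *\<^sub>R complex_of_real c)) = (\<lambda>s. of_real (double_exp 1 x s * exp (s * c)))"
    by (simp add: scaleR_conv_of_real exp_of_real flip: of_real_mult)
  then have "has_bochner_integral lborel (\<lambda>s. complex_of_real (double_exp 1 x s * exp (s * c)))
      (of_real (K_weight c x))"
    using has_bochner_integral_K_kernel[OF assms, of "of_real c"] K_kernel_of_real[OF assms, of c] by simp
  from has_bochner_integral_Re[OF this] show ?thesis by simp
qed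

lemma K_weight_pos:
  assumes "0 < x"
  shows "0 < K_weight c x"
proof -
  let ?f = "\<lambda>s. double_exp 1 x s * exp (s * c)"
  have int: "integrable lborel ?f" and eq: "integral\<^sup>L lborel ?f = K_weight c x"
    using has_bochner_integral_K_weight[OF assms, of c] by (auto simp: has_bochner_integral_iff)
  have pos: "0 < ?f s" for s by (simp add: double_exp_pos)
  have "integral\<^sup>L lborel ?f \<noteq> 0"
  proof
    assume "integral\<^sup>L lborel ?f = 0"
    then have "AE s in lborel. ?f s = 0"
      using pos by (subst (asm) integral_nonneg_eq_0_iff_AE[OF int]) (auto intro: less_imp_le)
    then have "AE s :: real in lborel. False"
      by eventually_elim (metis less_irrefl pos)
    then show False
      unfolding eventually_False ae_filter_eq_bot_iff by simp
  qed
  moreover have "0 \<le> integral\<^sup>L lborel ?f"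
    using pos by (intro integral_nonneg_AE) (auto intro: less_imp_le)
  ultimately show ?thesis using eq by simp
qed

lemma norm_K_kernel_le:
  assumes "0 < x"
  shows "norm (K_kernel z x) \<le> K_weight (Re z) x"
proof -
  have "norm (integral\<^sup>L lborel (\<lambda>s. double_exp 1 x s *\<^sub>R exp (s *\<^sub>R z)))
      \<le> (\<integral>s. norm (double_exp 1 x s *\<^sub>R exp (s *\<^sub>R z)) \<partial>lborel)"
    by (rule integral_norm_bound)
  then show ?thesis
    using has_bochner_integral_K_kernel[OF assms, of z] has_bochner_integral_K_weight[OF assms, of "Re z"]
    unfolding norm_double_exp_integrand by (simp add: has_bochner_integral_iff)
qed

lemma borel_measurable_bessel_K [measurable (raw)]:
  fixes z :: "'a :: {banach, real_normed_field, second_countable_topology}"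
  assumes [measurable]: "f \<in> borel_measurable M"
  shows "(\<lambda>x. bessel_K z (f x)) \<in> borel_measurable M"
  unfolding bessel_K_def set_lebesgue_integral_def by measurable

text \<open>
  The values at negative arguments depend on the branch of the logarithm; they are spelled out so
  that measurability holds on the whole line.
\<close>
lemma borel_measurable_of_real_powr [measurable (raw)]:
  assumes [measurable]: "f \<in> borel_measurable M"
  shows "(\<lambda>x. complex_of_real (f x) powr z) \<in> borel_measurable M"
proof -
  have "complex_of_real t powr z =
      (if t = 0 then 0 else if 0 < t then exp (z * of_real (ln t)) else exp (z * (of_real (ln (- t)) + \<i> * pi)))" for t
    using Ln_minus[of "of_real (- t)"] Ln_of_real[of "- t"] by (auto simp: powr_def Ln_of_real)
  then show ?thesis by simp
qed

lemma borel_measurable_K_weight [measurable (raw)]: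
  assumes [measurable]: "f \<in> borel_measurable M"
  shows "(\<lambda>x. K_weight c (f x)) \<in> borel_measurable M"
  unfolding K_weight_def by measurable

lemma borel_measurable_K_kernel [measurable (raw)]:
  assumes [measurable]: "f \<in> borel_measurable M"
  shows "(\<lambda>x. K_kernel c (f x)) \<in> borel_measurable M"
  unfolding K_kernel_def by measurable

definition conv_kernel :: "real \<Rightarrow> real \<Rightarrow> real \<Rightarrow> real" where
  "conv_kernel u v x = bessel_K 0 (2 * sqrt ((x + u) * (x + v) / x))"

lemma borel_measurable_conv_kernel [measurable (raw)]:
  assumes [measurable]: "f \<in> borel_measurable M" "g \<in> borel_measurable M" "h \<in> borel_measurable M"
  shows "(\<lambda>x. conv_kernel (f x) (g x) (h x)) \<in> borel_measurable M"
  unfolding conv_kernel_def by measurable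

lemma conv_kernel_nonneg: "0 \<le> conv_kernel u v x"
  unfolding conv_kernel_def bessel_K_def set_lebesgue_integral_def
  by (intro integral_nonneg_AE AE_I2) simp

text \<open>
  The reason why a convolution exists at all: double exponential weights are closed under
  products, also after the reflection and translation \<open>s \<mapsto> y - s\<close>.
\<close>
lemma double_exp_mult:
  "double_exp 1 u s * double_exp 1 v (y - s) = double_exp (1 + v * exp (- y)) (u + exp y) s"
  by (simp add: double_exp_def algebra_simps flip: exp_add)

text \<open>
  The product formula.  The product of the integrals for \<open>k\<^sub>z(u)\<close> and \<open>k\<^sub>z(v)\<close> is a convolution in
  disguise: with \<open>y\<close> the sum of the two variables, the exponential factors combine to \<open>e\<^sup>y\<^sup>z\<close>, and what
  is left for the inner integral is a double exponential weight of order \<open>0\<close>.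
\<close>
lemma mellin_conv_kernel:
  fixes z :: complex
  assumes u: "0 < u" and v: "0 < v"
  shows "set_integrable lborel {0<..} (\<lambda>x. of_real x powr (z - 1) * (2 * of_real (conv_kernel u v x)))" (is ?I)
    and "(LBINT x:{0<..}. of_real x powr (z - 1) * (2 * of_real (conv_kernel u v x)))
           = K_kernel z u * K_kernel z v" (is ?E)
proof -
  define G where "G u = (\<lambda>s. double_exp 1 u s *\<^sub>R exp (s *\<^sub>R z))" for u
  have G: "integrable lborel (G w)" "integral\<^sup>L lborel (G w) = K_kernel z w" if "0 < w" for w
    using has_bochner_integral_K_kernel[OF that, of z] by (auto simp: G_def has_bochner_integral_iff)
  have [measurable]: "G w \<in> borel_measurable borel" for w
    unfolding G_def by measurable
  have shift: "integrable lborel (\<lambda>y. G v (y - s))" "(\<integral>y. G v (y - s) \<partial>lborel) = K_kernel z v" 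
    "(\<integral>y. norm (G v (y - s)) \<partial>lborel) = (\<integral>y. norm (G v y) \<partial>lborel)" for s
    using lborel_integrable_real_affine[OF G(1)[OF v], of 1 "- s"]
      lborel_integral_real_affine[of 1 "G v" "- s"] G(2)[OF v]
      lborel_integral_real_affine[of 1 "\<lambda>y. norm (G v y)" "- s"] by simp_all
  let ?F = "\<lambda>s y. G u s * G v (y - s)"
  have intF: "integrable (lborel \<Otimes>\<^sub>M lborel) (\<lambda>(s, y). ?F s y)"
    by (rule lborel_pair.Fubini_integrable)
       (auto simp: norm_mult shift intro!: integrable_mult_left integrable_mult_right integrable_norm G u)
  define h where "h x = of_real x powr z * (2 * complex_of_real (conv_kernel u v x))" for x
  have [measurable]: "h \<in> borel_measurable borel" unfolding h_def by measurable
  have inner: "(\<integral>s. ?F s y \<partial>lborel) = h (exp y)" for y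
  proof -
    let ?a = "1 + v * exp (- y)" and ?b = "u + exp y"
    have ab: "0 < ?a" "0 < ?b" using u v by (auto intro: add_pos_pos)
    have F_eq: "?F s y = exp (y *\<^sub>R z) * (double_exp ?a ?b s *\<^sub>R exp (s *\<^sub>R 0))" for s
      using exp_scaleR_add[of s "y - s" z]
      by (simp add: G_def flip: double_exp_mult)
    have hbi: "has_bochner_integral lborel (\<lambda>s. double_exp ?a ?b s *\<^sub>R exp (s *\<^sub>R 0))
        (2 * complex_of_real (conv_kernel u v (exp y)))"
    proof -
      have "?a * ?b = (exp y + u) * (exp y + v) / exp y"
        by (simp add: exp_minus field_simps)
      moreover have "of_real (?b / ?a) powr (0 / 2) = (1::complex)"
        using ab by (simp add: powr_def del: of_real_divide of_real_add)
      ultimately show ?thesis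
        using has_bochner_integral_double_exp[OF ab, of 0] bessel_K_of_real[of 0]
        by (simp add: conv_kernel_def)
    qed
    have "of_real (exp y) powr z = exp (y *\<^sub>R z)"
      by (simp add: powr_def Ln_of_real scaleR_conv_of_real mult.commute flip: exp_of_real)
    then show ?thesis
      by (simp only: F_eq integral_mult_right_zero has_bochner_integral_integral_eq[OF hbi] h_def)
  qed
  have int: "integrable lborel (\<lambda>y. h (exp y))"
    using lborel_pair.integrable_snd[OF intF] by (simp add: inner)
  have "(LBINT y. h (exp y)) = (\<integral>s. (\<integral>y. ?F s y \<partial>lborel) \<partial>lborel)"
    using lborel_pair.integral_snd[OF intF] lborel_pair.integral_fst[OF intF] by (simp add: inner)
  also have "\<dots> = K_kernel z u * K_kernel z v"
    using G[OF u] by (simp add: shift)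
  finally have val: "(LBINT y. h (exp y)) = K_kernel z u * K_kernel z v" .
  have h_eq: "h x /\<^sub>R x = of_real x powr (z - 1) * (2 * of_real (conv_kernel u v x))" if "x \<in> {0<..}" for x
    using that by (simp add: h_def powr_diff scaleR_conv_of_real field_simps)
  have "set_integrable lborel {0<..} (\<lambda>x. h x /\<^sub>R x) \<longleftrightarrow> ?I"
    by (intro set_integrable_cong refl h_eq)
  with exp_substitution(1)[of h] int show ?I by simp
  have "(LBINT x:{0<..}. h x /\<^sub>R x)
      = (LBINT x:{0<..}. of_real x powr (z - 1) * (2 * of_real (conv_kernel u v x)))"
    by (rule set_lebesgue_integral_cong) (use h_eq in auto)
  with exp_substitution(2)[of h] int val show ?E by simp
qed

section \<open>Existence, factorization and Young inequality for absolutely integrable functions\<close>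
lemma mellin_norm_conv_kernel:
  fixes z :: complex
  assumes u: "0 < u" and v: "0 < v"
  shows "(LBINT x:{0<..}. norm (of_real x powr (z - 1) * (2 * complex_of_real (conv_kernel u v x))))
           = K_weight (Re z) u * K_weight (Re z) v"
proof -
  let ?c = "complex_of_real (Re z)"
  have "of_real (LBINT x:{0<..}. norm (of_real x powr (z - 1) * (2 * complex_of_real (conv_kernel u v x))))
      = (LBINT x:{0<..}. of_real x powr (?c - 1) * (2 * complex_of_real (conv_kernel u v x)))"
    unfolding set_lebesgue_integral_def integral_complex_of_real[symmetric]
  proof (intro Bochner_Integration.integral_cong refl)
    fix x :: real
    show "complex_of_real (indicator {0<..} x *\<^sub>R
            norm (of_real x powr (z - 1) * (2 * complex_of_real (conv_kernel u v x))))
        = indicator {0<..} x *\<^sub>R (of_real x powr (?c - 1) * (2 * of_real (conv_kernel u v x)))"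
      using powr_of_real[of x "Re z - 1"] norm_powr_real_powr[of x "z - 1"]
      by (cases "0 < x") (auto simp: norm_mult conv_kernel_nonneg)
  qed
  also have "\<dots> = of_real (K_weight (Re z) u * K_weight (Re z) v)"
    by (simp add: mellin_conv_kernel(2)[OF u v] K_kernel_of_real u v)
  finally show ?thesis
    by (simp only: of_real_eq_iff)
qed

text \<open>
  Extension by zero.  Measurability of a function in the weighted space is only known on the
  half-line, and this total function is the one to which Fubini's theorem applies.
\<close>
definition half_line_part :: "(real \<Rightarrow> complex) \<Rightarrow> real \<Rightarrow> complex" where
  "half_line_part f x = indicator {0<..} x *\<^sub>R f x"

lemma half_line_part_measurable:
  assumes "f \<in> weighted_L1 (K_weight c)"
  shows "half_line_part f \<in> borel_measurable borel"
proof -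
  have [measurable]: "(\<lambda>x. indicator {0<..} x *\<^sub>R (K_weight c x *\<^sub>R f x)) \<in> borel_measurable borel"
    using assms by (auto simp: weighted_L1_def set_integrable_def dest: borel_measurable_integrable)
  have "half_line_part f = (\<lambda>x. (1 / K_weight c x) *\<^sub>R (indicator {0<..} x *\<^sub>R (K_weight c x *\<^sub>R f x)))"
    using K_weight_pos[of _ c] by (force simp: half_line_part_def indicator_def)
  then show ?thesis by (rule ssubst) measurable
qed

lemma weighted_L1_iff:
  "f \<in> weighted_L1 (K_weight c) \<longleftrightarrow> integrable lborel (\<lambda>x. K_weight c x *\<^sub>R half_line_part f x)"
proof -
  have "(\<lambda>x. K_weight c x *\<^sub>R half_line_part f x) = (\<lambda>x. indicator {0<..} x *\<^sub>R (K_weight c x *\<^sub>R f x))"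
    by (auto simp: half_line_part_def)
  then show ?thesis by (simp add: weighted_L1_def set_integrable_def)
qed

lemma conv_integrand_restrict:
  "indicator ({0<..} \<times> {0<..}) (u, v) *\<^sub>R conv_integrand f g x (u, v)
     = conv_kernel u v x *\<^sub>R (half_line_part f u * half_line_part g v)"
  by (auto simp: conv_integrand_def conv_kernel_def half_line_part_def indicator_def)

lemma conv_exists_iff:
  "conv_exists f g x \<longleftrightarrow>
     integrable (lborel \<Otimes>\<^sub>M lborel) (\<lambda>(u, v). conv_kernel u v x *\<^sub>R (half_line_part f u * half_line_part g v))"
proof -
  have "(\<lambda>p. indicator ({0<..} \<times> {0<..}) p *\<^sub>R conv_integrand f g x p)
      = (\<lambda>(u, v). conv_kernel u v x *\<^sub>R (half_line_part f u * half_line_part g v))"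
    by (intro ext) (metis (mono_tags, lifting) conv_integrand_restrict case_prod_conv surj_pair)
  then show ?thesis
    by (simp only: conv_exists_def set_integrable_def lborel_prod)
qed

lemma conv_eq:
  "conv f g x =
     2 * (\<integral>(u, v). conv_kernel u v x *\<^sub>R (half_line_part f u * half_line_part g v) \<partial>(lborel \<Otimes>\<^sub>M lborel))"
  unfolding conv_def set_lebesgue_integral_def lborel_prod
  by (intro arg_cong2[where f = "(*)"] refl Bochner_Integration.integral_cong)
     (auto simp: conv_integrand_restrict)

lemma conv_commute:
  assumes "half_line_part f \<in> borel_measurable borel" "half_line_part g \<in> borel_measurable borel"
  shows "conv f g x = conv g f x"
proof -
  note [measurable] = assms
  let ?h = "\<lambda>(u, v). conv_kernel u v x *\<^sub>R (half_line_part f u * half_line_part g v)"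
  have "(\<integral>(u, v). ?h (v, u) \<partial>(lborel \<Otimes>\<^sub>M lborel)) = integral\<^sup>L (lborel \<Otimes>\<^sub>M lborel) ?h"
    by (rule lborel_pair.integral_product_swap) measurable
  moreover have "(\<lambda>(u, v). ?h (v, u)) = (\<lambda>(u, v). conv_kernel u v x *\<^sub>R (half_line_part g u * half_line_part f v))"
    by (auto simp: conv_kernel_def mult_ac)
  ultimately show ?thesis by (simp add: conv_eq)
qed

lemma F_transform_eq: "F_transform f z = (\<integral>x. K_kernel z x * half_line_part f x \<partial>lborel)"
  unfolding F_transform_def set_lebesgue_integral_def integral_mult_right_zero[symmetric]
  by (intro Bochner_Integration.integral_cong refl)
     (simp add: F_integrand_def K_kernel_def half_line_part_def)

lemma F_exists_iff: "F_exists f z \<longleftrightarrow> integrable lborel (\<lambda>x. K_kernel z x * half_line_part f x)"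
proof -
  let ?h = "\<lambda>x. indicator {0<..} x *\<^sub>R F_integrand f z x"
  have "(\<lambda>x. K_kernel z x * half_line_part f x) = (\<lambda>x. 2 * ?h x)"
    by (simp add: F_integrand_def K_kernel_def half_line_part_def mult_ac)
  moreover have "integrable lborel ?h \<longleftrightarrow> integrable lborel (\<lambda>x. 2 * ?h x)"
    by (rule integrable_cmult_iff[symmetric]) simp
  ultimately show ?thesis by (simp only: F_exists_def set_integrable_def)
qed

lemma F_existsI:
  assumes f: "f \<in> weighted_L1 (K_weight (Re z))"
  shows "F_exists f z"
  unfolding F_exists_iff
proof (rule Bochner_Integration.integrable_bound[OF f[unfolded weighted_L1_iff]])
  note [measurable] = half_line_part_measurable[OF f]
  show "(\<lambda>x. K_kernel z x * half_line_part f x) \<in> borel_measurable lborel" by simp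
  have "norm (K_kernel z x * half_line_part f x) \<le> norm (K_weight (Re z) x *\<^sub>R half_line_part f x)" for x
    using norm_K_kernel_le[of x z] by (cases "0 < x")
      (auto simp: norm_mult half_line_part_def intro!: mult_right_mono)
  then show "AE x in lborel. norm (K_kernel z x * half_line_part f x) \<le> norm (K_weight (Re z) x *\<^sub>R half_line_part f x)"
    by simp
qed

text \<open>
  Integrating the norm of the triple integrand over \<open>x\<close> first gives, by the product formula,
  \<open>k\<^sub>c(u) \<bar>f(u)\<bar> \<cdot> k\<^sub>c(v) \<bar>g(v)\<bar>\<close> with \<open>c = Re z\<close>, which is integrable by assumption.  All three
  claims are then instances of Fubini's theorem.
\<close>
theorem conv_absolutely_convergent:
  assumes f: "f \<in> weighted_L1 (K_weight (Re z))" and g: "g \<in> weighted_L1 (K_weight (Re z))"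
  shows conv_exists_AE: "AE x in lborel. 0 < x \<longrightarrow> conv_exists f g x"
    and mellin_exists_conv: "mellin_exists (conv f g) z"
    and mellin_conv: "mellin (conv f g) z = F_transform f z * F_transform g z"
proof -
  interpret Q: pair_sigma_finite "lborel \<Otimes>\<^sub>M lborel :: (real \<times> real) measure" "lborel :: real measure"
    unfolding lborel_prod by (rule lborel_pair.pair_sigma_finite_axioms)
  let ?F = "half_line_part f" and ?G = "half_line_part g"
  note [measurable] = half_line_part_measurable[OF f] half_line_part_measurable[OF g]
  define m where "m u v x = of_real x powr (z - 1) * (2 * complex_of_real (conv_kernel u v x))" for u v x
  have [measurable]: "(\<lambda>x. m (a x) (b x) (c x)) \<in> borel_measurable M"
    if [measurable]: "a \<in> borel_measurable M" "b \<in> borel_measurable M" "c \<in> borel_measurable M" for a b c and M :: "'z measure"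
    unfolding m_def by measurable
  have m_int: "integrable lborel (\<lambda>x. indicator {0<..} x *\<^sub>R m u v x)"
    and m_val: "(\<integral>x. indicator {0<..} x *\<^sub>R m u v x \<partial>lborel) = K_kernel z u * K_kernel z v"
    and m_norm: "(\<integral>x. norm (indicator {0<..} x *\<^sub>R m u v x) \<partial>lborel) = K_weight (Re z) u * K_weight (Re z) v"
    if "0 < u" "0 < v" for u v
    using mellin_conv_kernel[OF that, of z] mellin_norm_conv_kernel[OF that, of z]
    by (simp_all add: m_def set_integrable_def set_lebesgue_integral_def)
  define T where "T = (\<lambda>(u, v) x. (indicator {0<..} x *\<^sub>R m u v x) * (?F u * ?G v))"
  have zero: "?F u * ?G v = 0" if "\<not> (0 < u \<and> 0 < v)" for u v
    using that by (auto simp: half_line_part_def)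
  have T_int: "integrable lborel (T p)" for p
  proof (cases p)
    case (Pair u v)
    show ?thesis
    proof (cases "0 < u \<and> 0 < v")
      case True
      then show ?thesis
        unfolding T_def Pair prod.case by (intro integrable_mult_left m_int) auto
    next
      case False
      then show ?thesis
        by (simp only: T_def Pair prod.case zero[OF False] mult_zero_right) simp
    qed
  qed
  have T_val: "(\<integral>x. T (u, v) x \<partial>lborel) = (K_kernel z u * ?F u) * (K_kernel z v * ?G v)" for u v
  proof (cases "0 < u \<and> 0 < v")
    case True
    then show ?thesis
      by (simp only: T_def prod.case integral_mult_left_zero m_val) (simp add: mult_ac)
  next
    case False
    then show ?thesis
      using zero[OF False] by (simp only: T_def prod.case) auto
  qed
  have T_norm: "(\<integral>x. norm (T (u, v) x) \<partial>lborel)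
      = norm (K_weight (Re z) u *\<^sub>R ?F u) * norm (K_weight (Re z) v *\<^sub>R ?G v)" for u v
  proof (cases "0 < u \<and> 0 < v")
    case True
    then show ?thesis
      by (simp only: T_def prod.case norm_mult integral_mult_left_zero m_norm)
         (simp add: abs_of_pos K_weight_pos mult_ac)
  next
    case False
    then show ?thesis
      using zero[OF False] by (simp only: T_def prod.case) auto
  qed
  have intT: "integrable ((lborel \<Otimes>\<^sub>M lborel) \<Otimes>\<^sub>M lborel) (\<lambda>(p, x). T p x)"
  proof (rule Q.Fubini_integrable)
    show "(\<lambda>(p, x). T p x) \<in> borel_measurable ((lborel \<Otimes>\<^sub>M lborel) \<Otimes>\<^sub>M lborel)"
      unfolding T_def case_prod_unfold by measurable
    have "integrable (lborel \<Otimes>\<^sub>M lborel)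
        (\<lambda>(u, v). norm (K_weight (Re z) u *\<^sub>R ?F u) * norm (K_weight (Re z) v *\<^sub>R ?G v))"
      using f g unfolding weighted_L1_iff by (intro integrable_tensor integrable_norm)
    also have "(\<lambda>(u, v). norm (K_weight (Re z) u *\<^sub>R ?F u) * norm (K_weight (Re z) v *\<^sub>R ?G v))
        = (\<lambda>p. \<integral>x. norm (T p x) \<partial>lborel)" (is "?l = ?r")
    proof
      show "?l p = ?r p" for p by (cases p) (simp only: prod.case T_norm)
    qed
    finally show "integrable (lborel \<Otimes>\<^sub>M lborel) (\<lambda>p. LBINT x. norm (case (p, x) of (p, x) \<Rightarrow> T p x))"
      by simp
  qed (simp add: T_int)
  have slice: "T p x = (2 * of_real x powr (z - 1)) *
      (case p of (u, v) \<Rightarrow> conv_kernel u v x *\<^sub>R (?F u * ?G v))" if "0 < x" for p x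
    using that by (auto simp: T_def m_def scaleR_conv_of_real mult_ac split: prod.split)
  have inner: "(\<integral>p. T p x \<partial>(lborel \<Otimes>\<^sub>M lborel)) = indicator {0<..} x *\<^sub>R mellin_integrand (conv f g) z x" for x
  proof (cases "0 < x")
    case True
    then show ?thesis
      by (simp add: slice mellin_integrand_def conv_eq mult_ac)
  next
    case False
    then show ?thesis by (simp add: T_def case_prod_unfold)
  qed
  have "AE x in lborel. integrable (lborel \<Otimes>\<^sub>M lborel) (\<lambda>p. T p x)"
    using Q.AE_integrable_snd[of T] intT by simp
  then show "AE x in lborel. 0 < x \<longrightarrow> conv_exists f g x"
    by eventually_elim (auto simp: slice conv_exists_iff integrable_cmult_iff)
  show "mellin_exists (conv f g) z"
    using Q.integrable_snd[of T] intT inner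
    by (simp add: mellin_exists_def set_integrable_def)
  have "mellin (conv f g) z = (\<integral>x. (\<integral>p. T p x \<partial>(lborel \<Otimes>\<^sub>M lborel)) \<partial>lborel)"
    using inner by (simp add: mellin_def set_lebesgue_integral_def)
  also have "\<dots> = (\<integral>p. (\<integral>x. T p x \<partial>lborel) \<partial>(lborel \<Otimes>\<^sub>M lborel))"
    using Q.integral_snd[of T] Q.integral_fst[of T] intT by simp
  also have "\<dots> = (\<integral>(u, v). (K_kernel z u * ?F u) * (K_kernel z v * ?G v) \<partial>(lborel \<Otimes>\<^sub>M lborel))"
  proof (intro Bochner_Integration.integral_cong refl)
    show "(\<integral>x. T p x \<partial>lborel) = (case p of (u, v) \<Rightarrow> (K_kernel z u * ?F u) * (K_kernel z v * ?G v))" for p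
      by (cases p) (simp only: prod.case T_val)
  qed
  also have "\<dots> = F_transform f z * F_transform g z"
    using F_existsI[OF f] F_existsI[OF g] unfolding F_exists_iff F_transform_eq
    by (rule integral_tensor)
  finally show "mellin (conv f g) z = F_transform f z * F_transform g z" .
qed

lemma conv_in_weighted_L1:
  assumes f: "f \<in> weighted_L1 (K_weight c)" and g: "g \<in> weighted_L1 (K_weight c)"
  shows "conv f g \<in> weighted_L1 (\<lambda>x. x powr (c - 1))"
proof -
  have "set_integrable lborel {0<..} (mellin_integrand (conv f g) (of_real c))"
    using mellin_exists_conv[of f "of_real c" g] f g by (simp add: mellin_exists_def)
  also have "?this \<longleftrightarrow> set_integrable lborel {0<..} (\<lambda>x. x powr (c - 1) *\<^sub>R conv f g x)"
    using powr_of_real[of _ "c - 1"]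
    by (intro set_integrable_cong refl) (simp add: mellin_integrand_def scaleR_conv_of_real mult.commute)
  finally show ?thesis by (simp add: weighted_L1_def)
qed

text \<open>
  The convolution of the absolute values majorizes \<open>\<bar>f * g\<bar>\<close>, and its weighted norm is a Mellin
  transform at the real point \<open>c\<close>, hence factorizes into the two norms.
\<close>
lemma conv_young_inequality:
  assumes f: "f \<in> weighted_L1 (K_weight c)" and g: "g \<in> weighted_L1 (K_weight c)"
  shows "weighted_L1_norm (\<lambda>x. x powr (c - 1)) (conv f g)
      \<le> weighted_L1_norm (K_weight c) f * weighted_L1_norm (K_weight c) g"
proof -
  define a where "a h = (\<lambda>x. complex_of_real (norm (h x)))" for h :: "real \<Rightarrow> complex"
  have a_L1: "a h \<in> weighted_L1 (K_weight c)" if "h \<in> weighted_L1 (K_weight c)" for h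
  proof -
    have "integrable lborel
        (\<lambda>x. complex_of_real (norm (indicator {0<..} x *\<^sub>R (K_weight c x *\<^sub>R h x))))"
      using that unfolding weighted_L1_def set_integrable_def
      by (intro integrable_of_real integrable_norm) simp
    moreover have "complex_of_real (norm (indicator {0<..} x *\<^sub>R (K_weight c x *\<^sub>R h x)))
        = indicator {0<..} x *\<^sub>R (K_weight c x *\<^sub>R a h x)" for x
      using K_weight_pos[of x c]
      by (cases "0 < x") (auto simp: a_def norm_mult abs_of_pos scaleR_conv_of_real)
    ultimately show ?thesis by (simp only: weighted_L1_def set_integrable_def mem_Collect_eq)
  qed
  have a_F: "F_transform (a h) (of_real c) = of_real (weighted_L1_norm (K_weight c) h)" for h
    unfolding F_transform_eq weighted_L1_norm_def set_lebesgue_integral_def integral_complex_of_real[symmetric]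
    by (intro Bochner_Integration.integral_cong refl)
       (simp add: half_line_part_def a_def K_kernel_of_real indicator_def)
  have a_pos: "half_line_part (a h) x = of_real (norm (half_line_part h x))" for h x
    by (simp add: half_line_part_def a_def indicator_def)
  define n where "n x = 2 * (\<integral>(u, v). norm (conv_kernel u v x *\<^sub>R (half_line_part f u * half_line_part g v))
      \<partial>(lborel \<Otimes>\<^sub>M lborel))" for x
  have a_conv: "conv (a f) (a g) x = of_real (n x)" for x
  proof -
    have "(\<integral>(u, v). conv_kernel u v x *\<^sub>R (half_line_part (a f) u * half_line_part (a g) v) \<partial>(lborel \<Otimes>\<^sub>M lborel))
      = (\<integral>p. complex_of_real (case p of (u, v) \<Rightarrow>
            norm (conv_kernel u v x *\<^sub>R (half_line_part f u * half_line_part g v))) \<partial>(lborel \<Otimes>\<^sub>M lborel))"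
      by (intro Bochner_Integration.integral_cong refl)
         (auto simp: a_pos norm_mult conv_kernel_nonneg scaleR_conv_of_real)
    then show ?thesis
      unfolding conv_eq n_def by simp
  qed
  have conv_le: "norm (conv f g x) \<le> n x" for x
  proof -
    have "norm (\<integral>(u, v). conv_kernel u v x *\<^sub>R (half_line_part f u * half_line_part g v) \<partial>(lborel \<Otimes>\<^sub>M lborel))
        \<le> (\<integral>p. norm (case p of (u, v) \<Rightarrow> conv_kernel u v x *\<^sub>R (half_line_part f u * half_line_part g v))
             \<partial>(lborel \<Otimes>\<^sub>M lborel))"
      by (rule integral_norm_bound)
    then show ?thesis
      by (simp add: conv_eq n_def norm_mult case_prod_unfold)
  qed
  have eq: "norm (indicator {0<..} x *\<^sub>R (x powr (c - 1) *\<^sub>R conv f' g' x))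
      = indicator {0<..} x *\<^sub>R (norm (conv f' g' x) * x powr (c - 1))" for x f' g'
    by (simp add: indicator_def)
  have int: "set_integrable lborel {0<..} (\<lambda>x. norm (conv f' g' x) * x powr (c - 1))"
    if "f' \<in> weighted_L1 (K_weight c)" "g' \<in> weighted_L1 (K_weight c)" for f' g'
    using integrable_norm[of lborel "\<lambda>x. indicator {0<..} x *\<^sub>R (x powr (c - 1) *\<^sub>R conv f' g' x)"]
      conv_in_weighted_L1[OF that]
    unfolding eq by (simp add: weighted_L1_def set_integrable_def)
  have n_nonneg: "0 \<le> n x" for x
    using conv_le[of x] norm_ge_zero order_trans by blast
  have le: "weighted_L1_norm (\<lambda>x. x powr (c - 1)) (conv f g)
      \<le> (LBINT x:{0<..}. norm (conv (a f) (a g) x) * x powr (c - 1))" (is "_ \<le> ?I")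
    unfolding weighted_L1_norm_def
    by (intro set_integral_mono int f g a_L1) (auto simp: a_conv n_nonneg intro!: mult_right_mono conv_le)
  have "complex_of_real ?I = mellin (conv (a f) (a g)) (of_real c)"
    unfolding mellin_def set_lebesgue_integral_def integral_complex_of_real[symmetric]
  proof (intro Bochner_Integration.integral_cong refl)
    fix x :: real
    show "complex_of_real (indicator {0<..} x *\<^sub>R (norm (conv (a f) (a g) x) * x powr (c - 1)))
        = indicator {0<..} x *\<^sub>R mellin_integrand (conv (a f) (a g)) (of_real c) x"
      using powr_of_real[of x "c - 1"] n_nonneg[of x] by (simp add: a_conv mellin_integrand_def indicator_def)
  qed
  also have "\<dots> = of_real (weighted_L1_norm (K_weight c) f * weighted_L1_norm (K_weight c) g)"
    using mellin_conv[of "a f" "of_real c" "a g"] a_L1 f g by (simp add: a_F)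
  finally show ?thesis
    using le by (simp only: of_real_eq_iff)
qed

section \<open>Comparison of the weights\<close>
lemma K_weight_le:
  assumes "0 < x" and int: "integrable lborel h"
    and le: "\<And>s. double_exp 1 x s * exp (s * c) \<le> h s"
  shows "K_weight c x \<le> integral\<^sup>L lborel h"
  using has_bochner_integral_K_weight[OF \<open>0 < x\<close>, of c] integral_mono[OF _ int le]
  by (simp add: has_bochner_integral_iff)

lemma K_weight_antimono:
  assumes "0 < x" "x \<le> y"
  shows "K_weight c y \<le> K_weight c x"
proof -
  have "K_weight c y \<le> (\<integral>s. double_exp 1 x s * exp (s * c) \<partial>lborel)"
    using assms has_bochner_integral_K_weight[of x c]
    by (intro K_weight_le mult_right_mono double_exp_antimono) (auto simp: has_bochner_integral_iff)
  then show ?thesis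
    using assms has_bochner_integral_K_weight[of x c] by (simp add: has_bochner_integral_iff)
qed

lemma K_weight_le_add:
  assumes "0 < x" and le: "\<And>s. exp (s * c) \<le> exp (s * a) + exp (s * b)"
  shows "K_weight c x \<le> K_weight a x + K_weight b x"
proof -
  have "has_bochner_integral lborel (\<lambda>s. double_exp 1 x s * exp (s * a) + double_exp 1 x s * exp (s * b))
      (K_weight a x + K_weight b x)"
    by (intro has_bochner_integral_add has_bochner_integral_K_weight assms)
  moreover have "double_exp 1 x s * exp (s * c)
      \<le> double_exp 1 x s * exp (s * a) + double_exp 1 x s * exp (s * b)" for s
    using mult_left_mono[OF le[of s], of "double_exp 1 x s"] double_exp_pos[of 1 x s]
    by (simp add: distrib_left)
  ultimately show ?thesis
    using K_weight_le[OF \<open>0 < x\<close>, of "\<lambda>s. double_exp 1 x s * exp (s * a) + double_exp 1 x s * exp (s * b)" c]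
    by (simp only: has_bochner_integral_iff)
qed

lemma exp_between:
  assumes "a \<le> c" "c \<le> b"
  shows "exp (s * c) \<le> exp (s * a) + exp (s * b :: real)"
proof (cases "0 \<le> s")
  case True
  then have "exp (s * c) \<le> exp (s * b)" using assms by (simp add: mult_left_mono)
  then show ?thesis by (smt (verit) exp_gt_zero)
next
  case False
  then have "exp (s * c) \<le> exp (s * a)" using assms by (simp add: mult_left_mono_neg)
  then show ?thesis by (smt (verit) exp_gt_zero)
qed

lemma K_weight_bounded:
  assumes "0 < c"
  obtains M where "0 < M" "\<And>x. 0 < x \<Longrightarrow> K_weight c x \<le> M"
proof
  let ?M = "\<integral>s. double_exp 1 0 s * exp (s * c) \<partial>lborel"
  show le: "K_weight c x \<le> ?M" if "0 < x" for x
    using that assms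
    by (intro K_weight_le integrable_double_exp_one_sided mult_right_mono double_exp_antimono) auto
  show "0 < ?M"
    using le[of 1] K_weight_pos[of 1 c] by simp
qed

text \<open>
  On the negative half of the \<open>s\<close>-axis \<open>e\<^sup>s\<^sup>c \<le> e\<^sup>s\<^sup>\<alpha>\<close>.  The positive half contributes at most a
  constant, which is harmless because \<open>k\<^sub>\<alpha>\<close> is bounded below on \<open>(0, X]\<close>.
\<close>
lemma K_weight_dominated_left:
  assumes "\<alpha> \<le> c"
  obtains C where "0 \<le> C" "\<And>x. 0 < x \<Longrightarrow> x \<le> X \<Longrightarrow> K_weight c x \<le> C * K_weight \<alpha> x"
proof (cases "0 < X")
  case True
  obtain M where M: "0 < M" "\<And>x. 0 < x \<Longrightarrow> K_weight (\<bar>c\<bar> + 1) x \<le> M"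
    by (rule K_weight_bounded[of "\<bar>c\<bar> + 1"]) auto
  have pos: "0 < K_weight \<alpha> X" by (rule K_weight_pos) fact
  show thesis
  proof
    show "0 \<le> 1 + M / K_weight \<alpha> X" using M pos by simp
    fix x assume x: "0 < x" "x \<le> X"
    have "K_weight c x \<le> K_weight \<alpha> x + K_weight (\<bar>c\<bar> + 1) x"
      using assms x by (intro K_weight_le_add exp_between) auto
    also have "\<dots> \<le> K_weight \<alpha> x + M"
      using M x by simp
    also have "M \<le> M / K_weight \<alpha> X * K_weight \<alpha> x"
      using K_weight_antimono[OF x, of \<alpha>] pos M by (simp add: field_simps)
    finally show "K_weight c x \<le> (1 + M / K_weight \<alpha> X) * K_weight \<alpha> x"
      by (simp add: distrib_right)
  qed
qed (auto intro: that[of 0])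

text \<open>
  For \<open>x \<ge> 1\<close> the double exponential weight favours the positive half of the \<open>s\<close>-axis, so the
  negative half may be reflected onto it.
\<close>
lemma K_weight_dominated_right:
  assumes "0 \<le> c" "c \<le> \<alpha>" "1 \<le> x"
  shows "K_weight c x \<le> 2 * K_weight \<alpha> x"
proof -
  let ?h = "\<lambda>s. double_exp 1 x s * exp (s * \<alpha>)"
  have h: "has_bochner_integral lborel ?h (K_weight \<alpha> x)"
    using assms by (intro has_bochner_integral_K_weight) simp
  then have "has_bochner_integral lborel (\<lambda>s. ?h (- s)) (K_weight \<alpha> x)"
    by (subst (asm) lborel_has_bochner_integral_real_affine_iff[where c = "-1" and t = 0]) auto
  from has_bochner_integral_add[OF h this]
  have sum: "has_bochner_integral lborel (\<lambda>s. ?h s + ?h (- s)) (2 * K_weight \<alpha> x)" by simp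
  have "double_exp 1 x s * exp (s * c) \<le> ?h s + ?h (- s)" for s
  proof (cases "0 \<le> s")
    case True
    then have "double_exp 1 x s * exp (s * c) \<le> ?h s"
      using assms by (intro mult_left_mono) (auto simp: mult_left_mono double_exp_pos less_imp_le)
    then show ?thesis by (simp add: add_increasing2 double_exp_pos less_imp_le)
  next
    case False
    have "(x - 1) * (exp (- s) - exp s) \<ge> 0"
      using False assms by (intro mult_nonneg_nonneg) auto
    then have "double_exp 1 x s \<le> double_exp 1 x (- s)"
      by (simp add: double_exp_def algebra_simps)
    moreover have "s * c \<le> - s * \<alpha>"
      using False assms by (smt (verit) mult_nonneg_nonneg mult_nonpos_nonneg)
    ultimately have "double_exp 1 x s * exp (s * c) \<le> ?h (- s)"
      by (intro mult_mono) (auto simp: double_exp_pos less_imp_le)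
    then show ?thesis by (simp add: add_increasing double_exp_pos less_imp_le)
  qed
  from K_weight_le[OF _ _ this] assms sum show ?thesis by (simp add: has_bochner_integral_iff)
qed

text \<open>
  On \<open>(0, 1]\<close> the weight of positive order \<open>c\<close> is bounded while \<open>k\<^sub>\<alpha>\<close> is bounded below.  This fails
  for \<open>c = 0 < \<alpha>\<close> because of the logarithmic singularity of \<open>K\<^sub>0\<close>.
\<close>
lemma K_weight_dominated:
  assumes "0 < c" "c \<le> \<alpha>"
  obtains C where "\<And>x. 0 < x \<Longrightarrow> K_weight c x \<le> C * K_weight \<alpha> x"
proof -
  obtain M where M: "0 < M" "\<And>x. 0 < x \<Longrightarrow> K_weight c x \<le> M"
    using K_weight_bounded[OF \<open>0 < c\<close>] by blast
  let ?C = "2 + M / K_weight \<alpha> 1"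
  have pos1: "0 < K_weight \<alpha> 1" by (rule K_weight_pos) simp
  have "K_weight c x \<le> ?C * K_weight \<alpha> x" if x: "0 < x" for x
  proof (cases "1 \<le> x")
    case True
    have "0 \<le> M / K_weight \<alpha> 1 * K_weight \<alpha> x"
      using M pos1 K_weight_pos[OF x, of \<alpha>] by simp
    then show ?thesis
      using K_weight_dominated_right[of c \<alpha> x] assms True by (simp add: distrib_right)
  next
    case False
    have "M \<le> M / K_weight \<alpha> 1 * K_weight \<alpha> x"
      using K_weight_antimono[of x 1 \<alpha>] pos1 M x False by (simp add: field_simps)
    then show ?thesis
      using M(2)[OF x] K_weight_pos[OF x, of \<alpha>] by (simp add: distrib_right)
  qed
  then show thesis by (rule that)
qed

lemma weighted_L1_K_weight_mono:
  assumes f: "f \<in> weighted_L1 (K_weight \<alpha>)"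
    and le: "\<And>x. 0 < x \<Longrightarrow> K_weight c x \<le> C * K_weight \<alpha> x"
  shows "f \<in> weighted_L1 (K_weight c)"
  unfolding weighted_L1_iff
proof (rule Bochner_Integration.integrable_bound)
  note [measurable] = half_line_part_measurable[OF f]
  show "integrable lborel (\<lambda>x. C *\<^sub>R (K_weight \<alpha> x *\<^sub>R half_line_part f x))"
    using f unfolding weighted_L1_iff by (rule integrable_scaleR_right)
  show "(\<lambda>x. K_weight c x *\<^sub>R half_line_part f x) \<in> borel_measurable lborel" by simp
  have "norm (K_weight c x *\<^sub>R half_line_part f x) \<le> norm (C *\<^sub>R (K_weight \<alpha> x *\<^sub>R half_line_part f x))" for x
  proof (cases "0 < x")
    case True
    have "\<bar>K_weight c x\<bar> \<le> \<bar>C * K_weight \<alpha> x\<bar>"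
      using le[OF True] K_weight_pos[OF True, of c] by linarith
    then show ?thesis
      by (simp add: abs_mult flip: mult.assoc) (intro mult_right_mono, auto simp: abs_mult)
  qed (simp add: half_line_part_def)
  then show "AE x in lborel. norm (K_weight c x *\<^sub>R half_line_part f x)
      \<le> norm (C *\<^sub>R (K_weight \<alpha> x *\<^sub>R half_line_part f x))" by simp
qed

section \<open>Large arguments\<close>
lemma has_bochner_integral_bessel_K_real:
  fixes c :: real
  assumes "0 < y"
  shows "has_bochner_integral lborel (\<lambda>t. exp (- y * cosh t) * exp (t * c)) (2 * bessel_K c y)"
proof -
  have "(\<lambda>t. exp (- y * cosh t) *\<^sub>R exp (t *\<^sub>R complex_of_real c))
      = (\<lambda>t. of_real (exp (- y * cosh t) * exp (t * c)))"
    by (simp add: scaleR_conv_of_real exp_of_real flip: of_real_mult)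
  then have "has_bochner_integral lborel (\<lambda>t. complex_of_real (exp (- y * cosh t) * exp (t * c)))
      (2 * of_real (bessel_K c y))"
    using has_bochner_integral_double_exp_symmetric[OF assms, of "of_real c"] bessel_K_of_real[of c y] by simp
  from has_bochner_integral_Re[OF this] show ?thesis by simp
qed

text \<open>
  For large \<open>y\<close> the mass of \<open>exp (- y cosh t)\<close> concentrates at \<open>t = 0\<close>, where the oscillating factor
  \<open>cos (t Im z)\<close> of the real part is close to \<open>1\<close>.  The window \<open>\<bar>t\<bar> \<le> \<delta>\<close> is chosen so that the factor
  is at least \<open>1/2\<close> on it.  Outside the window the integrand is of size \<open>exp (- y cosh \<delta>)\<close>, whereas
  the window of half the width already carries mass of order \<open>exp (- y cosh (\<delta>/2))\<close>.
\<close>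
lemma bessel_K_norm_lower_bound:
  fixes z :: complex
  obtains Y where "0 < Y" "\<And>y. Y \<le> y \<Longrightarrow> bessel_K (Re z) y \<le> 4 * norm (bessel_K z y)"
proof -
  define c where "c = Re z"
  define \<tau> where "\<tau> = Im z"
  define \<delta> where "\<delta> = 1 / (\<bar>\<tau>\<bar> + 1)"
  have \<delta>: "0 < \<delta>" "\<bar>\<tau>\<bar> * \<delta> \<le> 1" by (auto simp: \<delta>_def field_simps)
  define J where "J y = 2 * bessel_K c y" for y
  define A where "A y t = exp (- y * cosh t) * exp (t * c)" for y t
  have A: "has_bochner_integral lborel (A y) (J y)" if "0 < y" for y
    using has_bochner_integral_bessel_K_real[OF that, of c] by (simp add: A_def[abs_def] J_def)
  have A_pos: "0 < A y t" for y t by (simp add: A_def)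
  have J_nonneg: "0 \<le> J y" if "0 < y" for y
    using A[OF that] A_pos
    by (metis has_bochner_integral_integral_eq integral_nonneg_AE AE_I2 less_imp_le)
  define d where "d = cosh \<delta> - cosh (\<delta> / 2)"
  have d: "0 < d" using \<delta> cosh_real_strict_mono[of "\<delta> / 2" \<delta>] by (simp add: d_def)
  \<comment> \<open>The threshold below which \<open>exp (- y d)\<close> makes the tail at most one sixth of the full mass;
      \<open>J 1 + 1\<close> is used in place of \<open>J 1\<close> to have a positive denominator.\<close>
  define \<kappa> where "\<kappa> = \<delta> * exp (- \<bar>c\<bar> * \<delta> / 2) / (6 * exp (cosh \<delta>) * (J 1 + 1))"
  have \<kappa>: "0 < \<kappa>" using J_nonneg[of 1] \<delta> by (simp add: \<kappa>_def)
  define Y where "Y = max 1 (- ln \<kappa> / d)"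
  have "bessel_K c y \<le> 4 * norm (bessel_K z y)" if y: "Y \<le> y" for y
  proof -
    have y1: "1 \<le> y" "0 < y" using y by (auto simp: Y_def)
    have "- ln \<kappa> \<le> y * d" using y d by (simp add: Y_def field_simps)
    then have small: "exp (- (y * d)) \<le> \<kappa>"
      using \<kappa> by (metis exp_le_cancel_iff exp_ln minus_le_iff)
    let ?E = "exp (- (y - 1) * cosh \<delta>)"
    have tail: "A y t \<le> ?E * A 1 t" if "\<delta> < \<bar>t\<bar>" for t
    proof -
      have "cosh \<delta> \<le> cosh t"
        using that \<delta> cosh_real_nonneg_le_iff[of \<delta> "\<bar>t\<bar>"] by simp
      then have "(y - 1) * cosh \<delta> \<le> (y - 1) * cosh t"
        using y1 by (intro mult_left_mono) auto
      then have "exp (- y * cosh t) \<le> exp (- (y - 1) * cosh \<delta>) * exp (- 1 * cosh t)"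
        unfolding exp_add[symmetric] exp_le_cancel_iff by (simp add: algebra_simps)
      then show ?thesis
        unfolding A_def mult.assoc[symmetric] by (intro mult_right_mono) auto
    qed
    \<comment> \<open>The tail is subtracted \<open>3/2\<close> times: once for the sign of the cosine, and one half to
      cancel its share in the first term.\<close>
    have lower: "A y t / 2 - 3 / 2 * (?E * A 1 t) \<le> A y t * cos (\<tau> * t)" for t
    proof (cases "\<bar>t\<bar> \<le> \<delta>")
      case True
      have "\<bar>\<tau> * t\<bar> \<le> 1"
        using \<delta> mult_left_mono[OF True, of "\<bar>\<tau>\<bar>"] by (simp add: abs_mult)
      then have "cos (pi / 3) \<le> cos \<bar>\<tau> * t\<bar>"
        using pi_gt3 by (intro cos_monotone_0_pi_le) auto
      then have "1 / 2 \<le> cos (\<tau> * t)" by (simp add: cos_60)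
      then have "A y t * (1 / 2) \<le> A y t * cos (\<tau> * t)"
        using A_pos[of y t] by (intro mult_left_mono) auto
      moreover have "0 \<le> ?E * A 1 t" using A_pos[of 1 t] by simp
      ultimately show ?thesis by simp
    next
      case False
      have "A y t * (-1) \<le> A y t * cos (\<tau> * t)"
        using A_pos[of y t] by (intro mult_left_mono) auto
      then show ?thesis using tail[of t] False by simp
    qed
    have Re_int: "has_bochner_integral lborel (\<lambda>t. A y t * cos (\<tau> * t)) (Re (2 * bessel_K z y))"
      using has_bochner_integral_Re[OF has_bochner_integral_double_exp_symmetric[OF y1(2), of z]]
      by (simp add: A_def[abs_def] Re_exp c_def \<tau>_def mult_ac)
    have low_int: "has_bochner_integral lborel (\<lambda>t. A y t / 2 - 3 / 2 * (?E * A 1 t)) (J y / 2 - 3 / 2 * (?E * J 1))"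
      by (intro has_bochner_integral_diff has_bochner_integral_divide_zero has_bochner_integral_mult_right A y1) auto
    have 1: "J y / 2 - 3 / 2 * (?E * J 1) \<le> Re (2 * bessel_K z y)"
      by (rule has_bochner_integral_mono_real[OF low_int Re_int lower])
    let ?D = "exp (- y * cosh (\<delta> / 2)) * exp (- \<bar>c\<bar> * \<delta> / 2)"
    have centre: "?D * indicator {- \<delta> / 2..\<delta> / 2} t \<le> A y t" for t
    proof (cases "t \<in> {- \<delta> / 2..\<delta> / 2}")
      case True
      then have t: "\<bar>t\<bar> \<le> \<delta> / 2" by auto
      then have "cosh t \<le> cosh (\<delta> / 2)"
        using cosh_real_nonneg_le_iff[of "\<bar>t\<bar>" "\<delta> / 2"] \<delta> by simp
      then have "exp (- y * cosh (\<delta> / 2)) \<le> exp (- y * cosh t)" using y1 by simp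
      moreover have "\<bar>t * c\<bar> \<le> \<bar>c\<bar> * \<delta> / 2"
        using mult_left_mono[OF t, of "\<bar>c\<bar>"] by (simp add: abs_mult mult.commute)
      then have "exp (- \<bar>c\<bar> * \<delta> / 2) \<le> exp (t * c)" by (simp add: abs_le_iff)
      ultimately have "?D \<le> A y t" unfolding A_def by (intro mult_mono) auto
      with True show ?thesis by simp
    qed (simp add: A_pos less_imp_le)
    have "has_bochner_integral lborel (\<lambda>t. ?D * indicator {- \<delta> / 2..\<delta> / 2} t) (?D * \<delta>)"
      using \<delta> has_bochner_integral_real_indicator[of "{- \<delta> / 2..\<delta> / 2}" lborel]
      by (intro has_bochner_integral_mult_right) (auto simp: field_simps)
    then have 2: "?D * \<delta> \<le> J y"
      by (rule has_bochner_integral_mono_real[OF _ A[OF y1(2)] centre])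
    have E_eq: "?E = exp (- (y * d)) * exp (- y * cosh (\<delta> / 2)) * exp (cosh \<delta>)"
      unfolding exp_add[symmetric] by (simp add: d_def algebra_simps)
    have "6 * (?E * J 1) \<le> 6 * (?E * (J 1 + 1))" by simp
    also have "\<dots> = 6 * (exp (- (y * d)) * exp (- y * cosh (\<delta> / 2)) * exp (cosh \<delta>) * (J 1 + 1))"
      by (simp only: E_eq)
    also have "\<dots>
        \<le> 6 * (\<kappa> * exp (- y * cosh (\<delta> / 2)) * exp (cosh \<delta>) * (J 1 + 1))"
      using small J_nonneg[of 1] by (intro mult_left_mono mult_right_mono) auto
    also have "\<dots> = (\<kappa> * (6 * exp (cosh \<delta>) * (J 1 + 1))) * exp (- y * cosh (\<delta> / 2))"
      by (simp only: mult_ac)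
    also have "\<kappa> * (6 * exp (cosh \<delta>) * (J 1 + 1)) = \<delta> * exp (- \<bar>c\<bar> * \<delta> / 2)"
      unfolding \<kappa>_def using J_nonneg[of 1] by (intro nonzero_eq_divide_eq[THEN iffD1]) auto
    also have "\<delta> * exp (- \<bar>c\<bar> * \<delta> / 2) * exp (- y * cosh (\<delta> / 2)) = ?D * \<delta>"
      by (simp only: mult_ac)
    finally have "6 * (?E * J 1) \<le> J y" using 2 by (rule order_trans)
    then have "J y / 4 \<le> J y / 2 - 3 / 2 * (?E * J 1)" by linarith
    also note 1
    also have "Re (2 * bessel_K z y) \<le> norm (2 * bessel_K z y)" by (rule complex_Re_le_cmod)
    finally show ?thesis by (simp add: J_def norm_mult)
  qed
  moreover have "0 < Y" by (simp add: Y_def)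
  ultimately show thesis using that unfolding c_def by blast
qed

lemma K_weight_le_norm_K_kernel:
  obtains X where "0 < X" "\<And>x. X \<le> x \<Longrightarrow> K_weight (Re z) x \<le> 4 * norm (K_kernel z x)"
proof -
  obtain Y where Y: "0 < Y" "\<And>y. Y \<le> y \<Longrightarrow> bessel_K (Re z) y \<le> 4 * norm (bessel_K z y)"
    using bessel_K_norm_lower_bound[of z] by blast
  show thesis
  proof
    show "0 < (Y / 2)\<^sup>2" using Y by simp
    fix x assume x: "(Y / 2)\<^sup>2 \<le> x"
    then have "0 < x" using \<open>0 < (Y / 2)\<^sup>2\<close> by linarith
    have "Y / 2 \<le> sqrt x" using x by (rule real_le_rsqrt)
    then have "bessel_K (Re z) (2 * sqrt x) \<le> 4 * norm (bessel_K z (2 * sqrt x))" by (intro Y) simp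
    then have "2 * x powr (Re z / 2) * bessel_K (Re z) (2 * sqrt x)
        \<le> 2 * x powr (Re z / 2) * (4 * norm (bessel_K z (2 * sqrt x)))"
      by (intro mult_left_mono) auto
    then show "K_weight (Re z) x \<le> 4 * norm (K_kernel z x)"
      using \<open>0 < x\<close> norm_powr_real_powr[of x "z / 2"]
      by (simp add: K_weight_def K_kernel_def norm_mult mult_ac)
  qed
qed

text \<open>
  To the left of some \<open>X\<close> the weight of order \<open>Re z\<close> is controlled by \<open>k\<^sub>\<alpha>\<close>, to the right of it by
  the modulus of the complex kernel, whose integrability against \<open>f\<close> is what the existence of the
  transform means.
\<close>
lemma weighted_L1_if_F_exists:
  assumes f: "f \<in> weighted_L1 (K_weight \<alpha>)" and "\<alpha> \<le> Re z" and ex: "F_exists f z"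
  shows "f \<in> weighted_L1 (K_weight (Re z))"
  unfolding weighted_L1_iff
proof -
  note [measurable] = half_line_part_measurable[OF f]
  obtain X where X: "0 < X" "\<And>x. X \<le> x \<Longrightarrow> K_weight (Re z) x \<le> 4 * norm (K_kernel z x)"
    using K_weight_le_norm_K_kernel[of z] by blast
  obtain C where C: "0 \<le> C" "\<And>x. 0 < x \<Longrightarrow> x \<le> X \<Longrightarrow> K_weight (Re z) x \<le> C * K_weight \<alpha> x"
    using K_weight_dominated_left[OF \<open>\<alpha> \<le> Re z\<close>, of X] by blast
  let ?F = "half_line_part f"
  show "integrable lborel (\<lambda>x. K_weight (Re z) x *\<^sub>R ?F x)"
  proof (rule Bochner_Integration.integrable_bound)
    show "integrable lborel (\<lambda>x. C * norm (K_weight \<alpha> x *\<^sub>R ?F x) + 4 * norm (K_kernel z x * ?F x))"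
      using f ex unfolding weighted_L1_iff F_exists_iff
      by (intro Bochner_Integration.integrable_add integrable_mult_right integrable_norm)
    show "(\<lambda>x. K_weight (Re z) x *\<^sub>R ?F x) \<in> borel_measurable lborel" by simp
    have "norm (K_weight (Re z) x *\<^sub>R ?F x)
        \<le> C * norm (K_weight \<alpha> x *\<^sub>R ?F x) + 4 * norm (K_kernel z x * ?F x)" for x
    proof (cases "0 < x")
      case True
      have "K_weight (Re z) x \<le> C * K_weight \<alpha> x + 4 * norm (K_kernel z x)"
        using X(2)[of x] C K_weight_pos[OF True, of \<alpha>] True
        by (cases "x \<le> X") (auto intro: add_increasing add_increasing2)
      then have "K_weight (Re z) x * norm (?F x) \<le> (C * K_weight \<alpha> x + 4 * norm (K_kernel z x)) * norm (?F x)"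
        by (rule mult_right_mono) simp
      then show ?thesis
        using K_weight_pos[OF True, of \<alpha>] K_weight_pos[OF True, of "Re z"]
        by (simp add: norm_mult algebra_simps)
    qed (simp add: half_line_part_def)
    then show "AE x in lborel. norm (K_weight (Re z) x *\<^sub>R ?F x)
        \<le> norm (C * norm (K_weight \<alpha> x *\<^sub>R ?F x) + 4 * norm (K_kernel z x * ?F x))"
      by (auto intro: order_trans[OF _ abs_ge_self])
  qed
qed

section \<open>The boundary line\<close>

text \<open>
  The classical recurrence \<open>2 w K\<^sub>w(y) = y (K\<^bsub>w+1\<^esub>(y) - K\<^bsub>w-1\<^esub>(y))\<close>.  It is an integration by parts: the
  derivative of \<open>exp (- e\<^sup>s - x e\<^sup>-\<^sup>s) e\<^sup>s\<^sup>w\<close> has integral \<open>0\<close> over the line.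
\<close>
lemma K_kernel_recurrence:
  assumes x: "0 < x"
  shows "w * K_kernel w x = K_kernel (w + 1) x - of_real x * K_kernel (w - 1) x"
proof -
  define F where "F s = double_exp 1 x s *\<^sub>R exp (s *\<^sub>R w)" for s
  define F' where "F' s = w * F s - double_exp 1 x s *\<^sub>R exp (s *\<^sub>R (w + 1))
      + of_real x * (double_exp 1 x s *\<^sub>R exp (s *\<^sub>R (w - 1)))" for s
  have hbi: "has_bochner_integral lborel F' (w * K_kernel w x - K_kernel (w + 1) x + of_real x * K_kernel (w - 1) x)"
    unfolding F'_def F_def
    by (intro has_bochner_integral_add has_bochner_integral_diff has_bochner_integral_mult_right
        has_bochner_integral_K_kernel x)
  have deriv: "(F has_vector_derivative F' s) (at s)" for s
  proof -
    have "(double_exp 1 x has_real_derivative (- exp s + x * exp (- s)) * double_exp 1 x s) (at s)"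
      unfolding double_exp_def[abs_def] by (auto intro!: derivative_eq_intros simp: algebra_simps)
    moreover have "((\<lambda>s. exp (s *\<^sub>R w)) has_vector_derivative exp (s *\<^sub>R w) * w) (at s)"
      by (rule exp_scaleR_has_vector_derivative_right)
    ultimately have "(F has_vector_derivative
        double_exp 1 x s *\<^sub>R (exp (s *\<^sub>R w) * w)
          + ((- exp s + x * exp (- s)) * double_exp 1 x s) *\<^sub>R exp (s *\<^sub>R w)) (at s)"
      unfolding F_def by (intro has_vector_derivative_scaleR)
    also have "double_exp 1 x s *\<^sub>R (exp (s *\<^sub>R w) * w)
          + ((- exp s + x * exp (- s)) * double_exp 1 x s) *\<^sub>R exp (s *\<^sub>R w) = F' s"
    proof -
      have "exp (s *\<^sub>R (w + 1)) = of_real (exp s) * exp (s *\<^sub>R w)"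
        "exp (s *\<^sub>R (w - 1)) = of_real (exp (- s)) * exp (s *\<^sub>R w)"
        using exp_add[of "of_real s" "s *\<^sub>R w"] exp_add[of "of_real (- s)" "s *\<^sub>R w"]
        by (simp_all add: scaleR_conv_of_real algebra_simps flip: exp_of_real)
      then show ?thesis
        by (simp add: F'_def F_def scaleR_conv_of_real algebra_simps)
    qed
    finally show ?thesis .
  qed
  have norm_F: "norm (F s) = exp (- (exp s + x * exp (- s))) * exp (s * Re w)" for s
    unfolding F_def norm_double_exp_integrand by (simp add: double_exp_def)
  have "((\<lambda>s. norm (F s)) \<longlongrightarrow> 0) at_top" "((\<lambda>s. norm (F s)) \<longlongrightarrow> 0) at_bot"
    unfolding norm_F using x by real_asymp+
  then have lim: "(F \<longlongrightarrow> 0) at_top" "(F \<longlongrightarrow> 0) at_bot"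
    by (simp_all add: tendsto_norm_zero_iff)
  have cont: "isCont F' s" for s
    unfolding F'_def F_def double_exp_def by (intro continuous_intros)
  have "(LBINT s=-\<infinity>..\<infinity>. F' s) = 0 - 0"
  proof (rule interval_integral_FTC_integrable)
    show "set_integrable lborel (einterval (- \<infinity>) \<infinity>) F'"
      using hbi by (simp add: set_integrable_def has_bochner_integral_iff)
  qed (use lim deriv cont in \<open>auto simp: ereal_tendsto_simps\<close>)
  moreover have "(LBINT s=-\<infinity>..\<infinity>. F' s) = integral\<^sup>L lborel F'"
    by (simp add: interval_lebesgue_integral_def set_lebesgue_integral_def)
  ultimately show ?thesis
    using has_bochner_integral_integral_eq[OF hbi] by (simp add: algebra_simps)
qed

lemma bessel_K_minus: "bessel_K (- z) x = bessel_K z x"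
  by (simp add: bessel_K_def)

lemma K_weight_reflect: "0 < x \<Longrightarrow> x * K_weight (c - 1) x = x powr c * K_weight (1 - c) x"
  using bessel_K_minus[of "1 - c" "2 * sqrt x"] powr_mult_base[of x "(c - 1) / 2"]
  by (simp add: K_weight_def field_simps flip: powr_add)

text \<open>
  Near the origin the recurrence expresses the kernel of order \<open>w = z + \<epsilon>\<close> by kernels of real parts
  \<open>1 + \<epsilon>\<close> and, after the reflection of the order, \<open>1 - \<epsilon>\<close>.  For \<open>\<epsilon> \<le> 1/2\<close> these lie in
  \<open>[1/2, 3/2]\<close>, away from the logarithmic case, so they are uniformly bounded; the price is the
  factor \<open>1 / \<bar>w\<bar> \<le> 1 / \<bar>Im z\<bar>\<close>.
\<close>
lemma K_kernel_dominated_at_boundary: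
  assumes "0 < \<alpha>" and z: "Re z = 0" "z \<noteq> 0"
  obtains C where "\<And>x \<epsilon>. 0 < x \<Longrightarrow> 0 \<le> \<epsilon> \<Longrightarrow> \<epsilon> \<le> min (1 / 2) \<alpha> \<Longrightarrow>
      norm (K_kernel (z + of_real \<epsilon>) x) \<le> C * K_weight \<alpha> x"
proof -
  obtain M where M: "0 < M" "\<And>x. 0 < x \<Longrightarrow> K_weight (1 / 2) x \<le> M"
    using K_weight_bounded[of "1 / 2"] by auto
  obtain N where N: "0 < N" "\<And>x. 0 < x \<Longrightarrow> K_weight (3 / 2) x \<le> N"
    using K_weight_bounded[of "3 / 2"] by auto
  have mid: "K_weight b x \<le> M + N" if "0 < x" "1 / 2 \<le> b" "b \<le> 3 / 2" for b x
    using K_weight_le_add[OF that(1) exp_between[OF that(2,3)]] M(2)[OF that(1)] N(2)[OF that(1)] by simp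
  have Im: "0 < \<bar>Im z\<bar>" using z by (auto simp: complex_eq_iff)
  have pos1: "0 < K_weight \<alpha> 1" by (rule K_weight_pos) simp
  let ?B = "2 * (M + N) / \<bar>Im z\<bar>"
  let ?C = "2 + ?B / K_weight \<alpha> 1"
  have "norm (K_kernel (z + of_real \<epsilon>) x) \<le> ?C * K_weight \<alpha> x"
    if x: "0 < x" and \<epsilon>: "0 \<le> \<epsilon>" "\<epsilon> \<le> min (1 / 2) \<alpha>" for x \<epsilon>
  proof (cases "1 \<le> x")
    case True
    have "norm (K_kernel (z + of_real \<epsilon>) x) \<le> K_weight \<epsilon> x"
      using norm_K_kernel_le[OF x, of "z + of_real \<epsilon>"] z by simp
    also have "\<dots> \<le> 2 * K_weight \<alpha> x"
      using \<epsilon> True by (intro K_weight_dominated_right) auto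
    also have "\<dots> \<le> ?C * K_weight \<alpha> x"
      using M(1) N(1) Im pos1 K_weight_pos[OF x, of \<alpha>] by (intro mult_right_mono) auto
    finally show ?thesis .
  next
    case False
    let ?w = "z + of_real \<epsilon>"
    have "\<bar>Im z\<bar> \<le> norm ?w" using abs_Im_le_cmod[of ?w] by simp
    then have "\<bar>Im z\<bar> * norm (K_kernel ?w x) \<le> norm (?w * K_kernel ?w x)"
      by (simp add: norm_mult mult_right_mono)
    also have "\<dots> \<le> norm (K_kernel (?w + 1) x) + x * norm (K_kernel (?w - 1) x)"
      unfolding K_kernel_recurrence[OF x] using x norm_triangle_ineq4 by (metis abs_of_pos norm_mult norm_of_real)
    also have "\<dots> \<le> K_weight (\<epsilon> + 1) x + x * K_weight (\<epsilon> - 1) x"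
      using norm_K_kernel_le[OF x, of "?w + 1"] norm_K_kernel_le[OF x, of "?w - 1"] x z
      by (intro add_mono mult_left_mono) auto
    also have "x * K_weight (\<epsilon> - 1) x \<le> K_weight (1 - \<epsilon>) x"
      unfolding K_weight_reflect[OF x]
      using K_weight_pos[OF x, of "1 - \<epsilon>"] False x \<epsilon>
      by (intro mult_left_le_one_le) (auto intro: powr_le1)
    also have "K_weight (\<epsilon> + 1) x + K_weight (1 - \<epsilon>) x \<le> 2 * (M + N)"
      using mid[OF x, of "\<epsilon> + 1"] mid[OF x, of "1 - \<epsilon>"] \<epsilon> by simp
    finally have "norm (K_kernel ?w x) \<le> ?B"
      using Im by (simp add: field_simps)
    also have "?B \<le> ?B / K_weight \<alpha> 1 * K_weight \<alpha> x"
      using K_weight_antimono[of x 1 \<alpha>] pos1 x False M(1) N(1) Im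
        mult_left_mono[of 1 "K_weight \<alpha> x / K_weight \<alpha> 1" ?B]
      by simp
    also have "\<dots> \<le> ?C * K_weight \<alpha> x"
      using K_weight_pos[OF x, of \<alpha>] by (simp add: distrib_right)
    finally show ?thesis .
  qed
  then show thesis by (rule that)
qed

lemma tendsto_K_kernel:
  assumes x: "0 < x" and \<epsilon>: "\<And>n. 0 \<le> \<epsilon> n" "\<And>n. \<epsilon> n \<le> m" "\<epsilon> \<longlonglongrightarrow> 0"
  shows "(\<lambda>n. K_kernel (z + of_real (\<epsilon> n)) x) \<longlonglongrightarrow> K_kernel z x"
proof -
  have eq: "K_kernel w x = (\<integral>s. double_exp 1 x s *\<^sub>R exp (s *\<^sub>R w) \<partial>lborel)" for w
    using has_bochner_integral_integral_eq[OF has_bochner_integral_K_kernel[OF x, of w]] by simp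
  let ?h = "\<lambda>s. double_exp 1 x s * exp (s * Re z) + double_exp 1 x s * exp (s * (Re z + m))"
  show ?thesis
    unfolding eq
  proof (rule integral_dominated_convergence)
    show "integrable lborel ?h"
      using x by (intro Bochner_Integration.integrable_add integrable_double_exp_real) auto
    have "(\<lambda>n. double_exp 1 x s *\<^sub>R exp (s *\<^sub>R (z + of_real (\<epsilon> n))))
        \<longlonglongrightarrow> double_exp 1 x s *\<^sub>R exp (s *\<^sub>R (z + of_real 0))" for s
      by (intro tendsto_intros \<epsilon>)
    then show "AE s in lborel. (\<lambda>n. double_exp 1 x s *\<^sub>R exp (s *\<^sub>R (z + of_real (\<epsilon> n))))
        \<longlonglongrightarrow> double_exp 1 x s *\<^sub>R exp (s *\<^sub>R z)" by simp
    have "norm (double_exp 1 x s *\<^sub>R exp (s *\<^sub>R (z + of_real (\<epsilon> n)))) \<le> ?h s" for n s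
      unfolding norm_double_exp_integrand distrib_left[symmetric]
      using \<epsilon>(1)[of n] \<epsilon>(2)[of n] double_exp_pos[of 1 x s]
      by (intro mult_left_mono exp_between) auto
    then show "AE s in lborel. norm (double_exp 1 x s *\<^sub>R exp (s *\<^sub>R (z + of_real (\<epsilon> n)))) \<le> ?h s" for n
      by blast
  qed measurable
qed

text \<open>
  Both sides are continuous from the right at \<open>z\<close>.  For the Mellin transform the majorant is
  \<open>x\<^bsup>\<epsilon>-1\<^esup> \<le> x\<^bsup>-1\<^esup> + x\<^bsup>\<alpha>-1\<^esup>\<close>, whose two parts are integrable against \<open>f * g\<close> because its Mellin transform
  exists at \<open>z\<close> and at \<open>\<alpha>\<close>.
\<close>
lemma mellin_conv_boundary:
  assumes \<alpha>: "0 < \<alpha>" and f: "f \<in> weighted_L1 (K_weight \<alpha>)" and g: "g \<in> weighted_L1 (K_weight \<alpha>)"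
    and z: "Re z = 0" "z \<noteq> 0" and ex: "mellin_exists (conv f g) z"
  shows "mellin (conv f g) z = F_transform f z * F_transform g z"
proof -
  define m where "m = min (1 / 2) \<alpha>"
  define \<epsilon> where "\<epsilon> n = m / real (Suc n)" for n
  have m: "0 < m" "m \<le> 1 / 2" "m \<le> \<alpha>" using \<alpha> by (auto simp: m_def)
  have \<epsilon>: "0 < \<epsilon> n" "\<epsilon> n \<le> m" for n
    using m by (auto simp: \<epsilon>_def divide_le_eq intro: mult_left_mono[of 1 _ m, simplified])
  have \<epsilon>0: "\<epsilon> \<longlonglongrightarrow> 0"
    unfolding \<epsilon>_def by real_asymp
  let ?w = "\<lambda>n. z + of_real (\<epsilon> n)"
  obtain C where C: "\<And>x \<epsilon>. 0 < x \<Longrightarrow> 0 \<le> \<epsilon> \<Longrightarrow> \<epsilon> \<le> min (1 / 2) \<alpha> \<Longrightarrow>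
      norm (K_kernel (z + of_real \<epsilon>) x) \<le> C * K_weight \<alpha> x"
    using K_kernel_dominated_at_boundary[OF \<alpha> z] by blast
  have F_lim: "(\<lambda>n. F_transform h (?w n)) \<longlonglongrightarrow> F_transform h z" if h: "h \<in> weighted_L1 (K_weight \<alpha>)" for h
    unfolding F_transform_eq
  proof (rule integral_dominated_convergence)
    note [measurable] = half_line_part_measurable[OF h]
    show "integrable lborel (\<lambda>x. C * norm (K_weight \<alpha> x *\<^sub>R half_line_part h x))"
      using h unfolding weighted_L1_iff by (intro integrable_mult_right integrable_norm)
    show "(\<lambda>x. K_kernel z x * half_line_part h x) \<in> borel_measurable lborel"
      "(\<lambda>x. K_kernel (?w n) x * half_line_part h x) \<in> borel_measurable lborel" for n by simp_all
    have "(\<lambda>n. K_kernel (?w n) x * half_line_part h x) \<longlonglongrightarrow> K_kernel z x * half_line_part h x" for x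
    proof (cases "0 < x")
      case True
      then show ?thesis
        using \<epsilon> \<epsilon>0 by (intro tendsto_intros tendsto_K_kernel[where m = m]) (auto intro: less_imp_le)
    qed (simp add: half_line_part_def)
    then show "AE x in lborel. (\<lambda>n. K_kernel (?w n) x * half_line_part h x) \<longlonglongrightarrow> K_kernel z x * half_line_part h x"
      by blast
    have "norm (K_kernel (?w n) x * half_line_part h x) \<le> C * norm (K_weight \<alpha> x *\<^sub>R half_line_part h x)" for n x
    proof (cases "0 < x")
      case True
      have "norm (K_kernel (?w n) x) \<le> C * K_weight \<alpha> x"
        using C[OF True, of "\<epsilon> n"] \<epsilon>[of n] by (simp add: m_def)
      then have "norm (K_kernel (?w n) x) * norm (half_line_part h x) \<le> C * K_weight \<alpha> x * norm (half_line_part h x)"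
        by (rule mult_right_mono) simp
      then show ?thesis
        using K_weight_pos[OF True, of \<alpha>] by (simp add: norm_mult mult_ac)
    qed (simp add: half_line_part_def)
    then show "AE x in lborel. norm (K_kernel (?w n) x * half_line_part h x)
        \<le> C * norm (K_weight \<alpha> x *\<^sub>R half_line_part h x)" for n by blast
  qed
  have L1: "h \<in> weighted_L1 (K_weight (Re (?w n)))" if h: "h \<in> weighted_L1 (K_weight \<alpha>)" for h n
  proof -
    have "0 < Re (?w n)" "Re (?w n) \<le> \<alpha>" using z \<epsilon>[of n] m by auto
    from K_weight_dominated[OF this] weighted_L1_K_weight_mono[OF h] show ?thesis by blast
  qed
  have ind: "integrable lborel (\<lambda>x. indicator {0<..} x *\<^sub>R mellin_integrand (conv f g) w x)"
    if "mellin_exists (conv f g) w" for w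
    using that by (simp add: mellin_exists_def set_integrable_def)
  have ex\<alpha>: "mellin_exists (conv f g) (of_real \<alpha>)"
    using f g by (intro mellin_exists_conv) auto
  have ex_n: "mellin_exists (conv f g) (?w n)" for n
    by (intro mellin_exists_conv L1 f g)
  have lim: "(\<lambda>n. mellin (conv f g) (?w n)) \<longlonglongrightarrow> mellin (conv f g) z"
    unfolding mellin_def set_lebesgue_integral_def
  proof (rule integral_dominated_convergence)
    let ?I = "\<lambda>w x. indicator {0<..} x *\<^sub>R mellin_integrand (conv f g) w x"
    show "integrable lborel (\<lambda>x. norm (?I z x) + norm (?I (of_real \<alpha>) x))"
      by (intro Bochner_Integration.integrable_add integrable_norm ind ex ex\<alpha>)
    show "?I z \<in> borel_measurable lborel" "?I (?w n) \<in> borel_measurable lborel" for n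
      using ind[OF ex] ind[OF ex_n] by (auto dest: borel_measurable_integrable)
    have "(\<lambda>n. ?I (?w n) x) \<longlonglongrightarrow> ?I z x" for x
    proof (cases "0 < x")
      case True
      have "(\<lambda>n. conv f g x * of_real x powr (?w n - 1)) \<longlonglongrightarrow> conv f g x * of_real x powr (z + of_real 0 - 1)"
        using True by (intro tendsto_intros \<epsilon>0) auto
      with True show ?thesis by (simp add: mellin_integrand_def)
    qed simp
    then show "AE x in lborel. (\<lambda>n. ?I (?w n) x) \<longlonglongrightarrow> ?I z x" by blast
    have "norm (?I (?w n) x) \<le> norm (?I z x) + norm (?I (of_real \<alpha>) x)" for n x
    proof (cases "0 < x")
      case True
      have "x powr (\<epsilon> n - 1) \<le> x powr (-1) + x powr (\<alpha> - 1)"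
        using exp_between[of "-1" "\<epsilon> n - 1" "\<alpha> - 1" "ln x"] \<epsilon>[of n] m True
        by (simp add: powr_def mult.commute)
      then have "norm (conv f g x) * x powr (\<epsilon> n - 1)
          \<le> norm (conv f g x) * (x powr (-1) + x powr (\<alpha> - 1))"
        by (rule mult_left_mono) simp
      then show ?thesis
        using True z by (simp add: mellin_integrand_def norm_mult norm_powr_real_powr distrib_left)
    qed simp
    then show "AE x in lborel. norm (?I (?w n) x) \<le> norm (?I z x) + norm (?I (of_real \<alpha>) x)" for n
      by blast
  qed
  have "(\<lambda>n. mellin (conv f g) (?w n)) \<longlonglongrightarrow> F_transform f z * F_transform g z"
    using tendsto_mult[OF F_lim[OF f] F_lim[OF g]] by (simp add: mellin_conv[OF L1[OF f] L1[OF g]])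
  with lim show ?thesis by (rule LIMSEQ_unique)
qed

section \<open>The factorization in the half-plane\<close>

text \<open>
  At \<open>z = 0\<close> the kernel coincides with its positive weight, so there the existence of the transform
  is the claim itself.
\<close>
lemma weighted_L1_in_half_plane:
  assumes f: "f \<in> weighted_L1 (K_weight \<alpha>)" and ex: "F_exists f z" and "\<alpha> \<le> Re z \<or> 0 < Re z \<or> z = 0"
  shows "f \<in> weighted_L1 (K_weight (Re z))"
  using assms(3)
proof (elim disjE)
  assume "\<alpha> \<le> Re z"
  then show ?thesis by (rule weighted_L1_if_F_exists[OF f _ ex])
next
  assume pos: "0 < Re z"
  show ?thesis
  proof (cases "\<alpha> \<le> Re z")
    case True
    then show ?thesis by (rule weighted_L1_if_F_exists[OF f _ ex])
  next
    case False
    with K_weight_dominated[OF pos, of \<alpha>] weighted_L1_K_weight_mono[OF f] show ?thesis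
      by (metis linear)
  qed
next
  assume "z = 0"
  have "K_weight 0 x *\<^sub>R half_line_part f x = K_kernel 0 x * half_line_part f x" for x
    using K_kernel_of_real[of x 0] by (cases "0 < x") (auto simp: half_line_part_def scaleR_conv_of_real)
  with ex \<open>z = 0\<close> show ?thesis by (simp add: weighted_L1_iff F_exists_iff)
qed

theorem theorem6:
  fixes \<alpha> :: real and f g :: "real \<Rightarrow> complex"
  assumes "f \<in> weighted_L1 (K_weight \<alpha>)" and "g \<in> weighted_L1 (K_weight \<alpha>)"
  shows "(AE x in lborel. 0 < x \<longrightarrow> conv_exists f g x)
    \<and> conv f g \<in> weighted_L1 (\<lambda>x. x powr (\<alpha> - 1))
    \<and> weighted_L1_norm (\<lambda>x. x powr (\<alpha> - 1)) (conv f g)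
        \<le> weighted_L1_norm (K_weight \<alpha>) f * weighted_L1_norm (K_weight \<alpha>) g
    \<and> (\<forall>x>0. conv f g x = conv g f x)
    \<and> (\<forall>z. (if 0 \<le> \<alpha> then 0 \<le> Re z else \<alpha> \<le> Re z) \<longrightarrow>
          (Re z \<le> \<alpha> \<and> (0 < \<alpha> \<longrightarrow> 0 < Re z) \<longrightarrow> F_exists f z \<and> F_exists g z)
        \<and> (F_exists f z \<and> F_exists g z \<and> (0 < \<alpha> \<longrightarrow> 0 < Re z) \<longrightarrow> mellin_exists (conv f g) z)
        \<and> (F_exists f z \<and> F_exists g z \<and> mellin_exists (conv f g) z \<longrightarrow>
             mellin (conv f g) z = F_transform f z * F_transform g z))"
proof (intro conjI allI impI; (elim conjE)?)
  note f = assms(1) and g = assms(2)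
  show "AE x in lborel. 0 < x \<longrightarrow> conv_exists f g x"
    using conv_exists_AE[of f "of_real \<alpha>" g] f g by simp
  show "conv f g \<in> weighted_L1 (\<lambda>x. x powr (\<alpha> - 1))"
    by (rule conv_in_weighted_L1[OF f g])
  show "weighted_L1_norm (\<lambda>x. x powr (\<alpha> - 1)) (conv f g)
      \<le> weighted_L1_norm (K_weight \<alpha>) f * weighted_L1_norm (K_weight \<alpha>) g"
    by (rule conv_young_inequality[OF f g])
  show "conv f g x = conv g f x" for x
    by (intro conv_commute half_line_part_measurable[OF f] half_line_part_measurable[OF g])
  fix z :: complex
  assume dom: "if 0 \<le> \<alpha> then 0 \<le> Re z else \<alpha> \<le> Re z"
  {
    assume le: "Re z \<le> \<alpha>" and pos: "0 < \<alpha> \<longrightarrow> 0 < Re z"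
    have "h \<in> weighted_L1 (K_weight (Re z))" if h: "h \<in> weighted_L1 (K_weight \<alpha>)" for h
    proof (cases "0 < \<alpha>")
      case True
      with K_weight_dominated[OF _ le] weighted_L1_K_weight_mono[OF h] pos show ?thesis by blast
    next
      case False
      with dom le have "Re z = \<alpha>" by (auto split: if_splits)
      with h show ?thesis by simp
    qed
    then show "F_exists f z" "F_exists g z"
      using f g by (blast intro: F_existsI)+
  next
    assume ex: "F_exists f z" "F_exists g z" and "0 < \<alpha> \<longrightarrow> 0 < Re z"
    then have "\<alpha> \<le> Re z \<or> 0 < Re z \<or> z = 0"
      using dom by (auto split: if_splits)
    with ex show "mellin_exists (conv f g) z"
      by (intro mellin_exists_conv weighted_L1_in_half_plane[OF f] weighted_L1_in_half_plane[OF g])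
  next
    assume ex: "F_exists f z" "F_exists g z" "mellin_exists (conv f g) z"
    show "mellin (conv f g) z = F_transform f z * F_transform g z"
    proof (cases "\<alpha> \<le> Re z \<or> 0 < Re z \<or> z = 0")
      case True
      with ex show ?thesis
        by (intro mellin_conv weighted_L1_in_half_plane[OF f] weighted_L1_in_half_plane[OF g])
    next
      case False
      with dom have "0 < \<alpha>" and z: "Re z = 0" "z \<noteq> 0" by (auto split: if_splits)
      show ?thesis by (rule mellin_conv_boundary[OF \<open>0 < \<alpha>\<close> f g z ex(3)])
    qed
  }
qed

end
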